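(* Let $\mathbb{F}_q$ be any finite field, and let $M=(E,I)$ be any non-free, $\mathbb{F}_q$-representable matroid with rank $r(M)$ and exactly $\ell$ loops. If $m,n\in\mathbb{N}$ satisfy (i) $m\geq r(M)$ and (ii) $n\geq|E|$, then $$ \mathbb{P}_{A\sim[U_q]^{m\times n}}\{M \text{ is a minor of } M[A]\} > \max_{k}\ \left(1-q^{-(n-k)}\right)\left(1-\left(1-p_{m-k,q,M}\right)^{\left\lfloor\frac{n-k}{|E|}\right\rfloor}\right), $$ where the maximum is over all integers $k$ with $0\leq k\leq\min(n-|E|,\,m-r(M))$, and $$ p_{s,q,M}=\binom{|E|}{\ell}\left(\frac{(q-1)^{|E|-r(M)-\ell}}{q^{s(|E|-r(M))}}\right)\prod_{i=0}^{r(M)-1}\left(1-q^{i-s}\right). $$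
   Context: $\mathbb{F}_q$ is the finite field with $q$ elements. $[U_q]^{m\times n}$ denotes the uniform distribution on $\mathbb{F}_q^{m\times n}$ (entries i.i.d. uniform on $\mathbb{F}_q$), and $A \sim [U_q]^{m \times n}$ means that $A$ is drawn from it. For a matrix $A$ over $\mathbb{F}_q$ with $n$ columns, $M[A]$ is the column dependence matroid of $A$: its ground set is the set of column indices $\{1,\dots,n\}$, and a set of indices is independent iff the corresponding columns form a linearly independent family. All matroids are finite; $M=(E,I)$ has ground set $E$ and collection of independent sets $I$. A matroid is $\mathbb{F}_q$-representable if it is isomorphic to $M[A]$ for some matrix $A$ over $\mathbb{F}_q$. A loop is an element belonging to no basis. A matroid is free if every subset of its ground set is independent, and non-free otherwise. "$M$ is a minor of $N$" means that $M$ is isomorphic to a matroid obtained from $N$ by a sequence of deletions and contractions. *)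

theory Defs
  imports
    "HOL-Probability.Probability_Mass_Function"
    "Jordan_Normal_Form.VS_Connect"
begin

text \<open>A pair \<open>(E, I)\<close> of a ground set and a collection of independent sets;
  the matroid axioms are the predicate \<open>matroid\<close> below.\<close>

type_synonym 'e matroid = "'e set \<times> 'e set set"

abbreviation ground :: "'e matroid \<Rightarrow> 'e set" where
  "ground M \<equiv> fst M"

abbreviation indeps :: "'e matroid \<Rightarrow> 'e set set" where
  "indeps M \<equiv> snd M"

definition matroid :: "'e matroid \<Rightarrow> bool" where
  "matroid M \<longleftrightarrow>
     finite (ground M) \<and> indeps M \<subseteq> Pow (ground M) \<and> {} \<in> indeps M \<and>
     (\<forall>X\<in>indeps M. \<forall>Y\<subseteq>X. Y \<in> indeps M) \<and>
     (\<forall>X\<in>indeps M. \<forall>Y\<in>indeps M. card X < card Y \<longrightarrow> (\<exists>y\<in>Y - X. insert y X \<in> indeps M))"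

definition basis_of :: "'e matroid \<Rightarrow> 'e set \<Rightarrow> 'e set \<Rightarrow> bool" where
  "basis_of M X B \<longleftrightarrow>
     B \<in> indeps M \<and> B \<subseteq> X \<and> (\<forall>C\<in>indeps M. B \<subseteq> C \<and> C \<subseteq> X \<longrightarrow> C = B)"

definition bases :: "'e matroid \<Rightarrow> 'e set set" where
  "bases M = {B. basis_of M (ground M) B}"

definition matroid_rank :: "'e matroid \<Rightarrow> nat" where
  "matroid_rank M = Max (card ` indeps M)"

definition loops :: "'e matroid \<Rightarrow> 'e set" where
  "loops M = {e \<in> ground M. \<forall>B\<in>bases M. e \<notin> B}"

definition free_matroid :: "'e matroid \<Rightarrow> bool" where
  "free_matroid M \<longleftrightarrow> (\<forall>X\<subseteq>ground M. X \<in> indeps M)"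

definition isomorphic :: "'e matroid \<Rightarrow> 'f matroid \<Rightarrow> bool" where
  "isomorphic M N \<longleftrightarrow>
     (\<exists>f. bij_betw f (ground M) (ground N) \<and>
          (\<forall>X\<subseteq>ground M. X \<in> indeps M \<longleftrightarrow> f ` X \<in> indeps N))"

definition deletion :: "'e matroid \<Rightarrow> 'e set \<Rightarrow> 'e matroid" where
  "deletion N X = (ground N - X, {J \<in> indeps N. J \<subseteq> ground N - X})"

text \<open>In a matroid the choice of the basis \<open>B\<close> of \<open>X\<close> in the contraction
  is immaterial.\<close>

definition contraction :: "'e matroid \<Rightarrow> 'e set \<Rightarrow> 'e matroid" where
  "contraction N X =
     (ground N - X, {J. J \<subseteq> ground N - X \<and> (\<exists>B. basis_of N X B \<and> J \<union> B \<in> indeps N)})"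

inductive minor_by_steps :: "'e matroid \<Rightarrow> 'e matroid \<Rightarrow> bool" for N where
  start: "minor_by_steps N N"
| delete: "minor_by_steps N L \<Longrightarrow> X \<subseteq> ground L \<Longrightarrow> minor_by_steps N (deletion L X)"
| contract: "minor_by_steps N L \<Longrightarrow> X \<subseteq> ground L \<Longrightarrow> minor_by_steps N (contraction L X)"

definition is_minor :: "'e matroid \<Rightarrow> 'f matroid \<Rightarrow> bool" where
  "is_minor M N \<longleftrightarrow> (\<exists>L. minor_by_steps N L \<and> isomorphic M L)"

text \<open>Columns are indexed from \<open>0\<close>. The columns indexed by \<open>J\<close> form a linearly independent
  \<^emph>\<open>family\<close>: equal columns with distinct indices are dependent, hence the injectivity
  requirement next to the library's independence of the \<^emph>\<open>set\<close> of columns.\<close>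

definition col_matroid :: "'a::field mat \<Rightarrow> nat matroid" where
  "col_matroid A =
     ({0..<dim_col A},
      {J. J \<subseteq> {0..<dim_col A} \<and> inj_on (col A) J \<and>
          LinearCombinations.module.lin_indpt class_ring
            (module_vec TYPE('a) (dim_row A)) (col A ` J)})"

definition representable :: "'a::field itself \<Rightarrow> 'e matroid \<Rightarrow> bool" where
  "representable _ M \<longleftrightarrow> (\<exists>A :: 'a mat. isomorphic M (col_matroid A))"

lemma finite_carrier_mat: "finite (carrier_mat m n :: 'a::finite mat set)"
proof (rule finite_subset)
  let ?F = "{f :: nat \<times> nat \<Rightarrow> 'a. \<forall>x. (x \<in> {0..<m} \<times> {0..<n} \<longrightarrow> f x \<in> UNIV)
              \<and> (x \<notin> {0..<m} \<times> {0..<n} \<longrightarrow> f x = undefined)}"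
  show "(carrier_mat m n :: 'a mat set) \<subseteq> mat m n ` ?F"
  proof
    fix A :: "'a mat" assume A: "A \<in> carrier_mat m n"
    let ?f = "\<lambda>x. if x \<in> {0..<m} \<times> {0..<n} then A $$ x else undefined"
    have "A = mat m n ?f" using A by (intro eq_matI) auto
    moreover have "?f \<in> ?F" by auto
    ultimately show "A \<in> mat m n ` ?F" by blast
  qed
  show "finite (mat m n ` ?F)"
    by (intro finite_imageI finite_set_of_finite_funs) auto
qed

text \<open>\<open>carrier_mat m n\<close> is finite and nonempty, so this is the uniform distribution on all
  \<open>m \<times> n\<close> matrices.\<close>

definition uniform_mat :: "nat \<Rightarrow> nat \<Rightarrow> 'a::{field,finite} mat pmf" where
  "uniform_mat m n = pmf_of_set (carrier_mat m n)"

text \<open>The number \<open>\<ell>\<close> of loops is read off from \<open>M\<close>. The natural-number subtractions do not truncate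
  for a matroid \<open>M\<close>, since \<open>r(M) + \<ell> \<le> |E|\<close>.\<close>

definition p_minor :: "nat \<Rightarrow> nat \<Rightarrow> 'e matroid \<Rightarrow> real" where
  "p_minor s q M =
     (let e = card (ground M); r = matroid_rank M; l = card (loops M) in
      real (e choose l) * ((real q - 1) ^ (e - r - l) / real q ^ (s * (e - r))) *
      (\<Prod>i<r. 1 - real q powi (int i - int s)))"

end

theory Submission
  imports Defs
begin

text \<open>
  Condition on the upper \<open>k\<close> rows of \<open>A\<close>, and choose a maximal independent set \<open>J\<close> of their columns.
  Then \<open>J\<close> has at most \<open>k\<close> elements, and contracting it leaves the column matroid of the lower rows
  after each column outside \<open>J\<close> is shifted by a combination of the columns in \<open>J\<close>. The shift preserves
  uniformity, so \<open>(n - k) div |E|\<close> disjoint blocks of \<open>|E|\<close> columns get independent chances to represent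
  \<open>M\<close>, each with probability at least \<open>p_minor (m - k) q M\<close>. The rank of the upper rows is irrelevant,
  so the factor \<open>1 - q^-(n-k)\<close> is not needed as a probability and only makes the inequality strict.

  For a single block, write \<open>M\<close> in coordinates with respect to a basis. Choosing the positions of the
  loops, an independent family to carry the basis, and a nonzero scalar for every other nonloop gives
  pairwise different representations of \<open>M\<close>.
\<close>

section \<open>Linear independence of finite families\<close>

text \<open>Both index sets are free, so one notion covers columns cut down to the upper or lower
  rows as well as coordinate vectors over a basis. Indexing by \<open>J\<close> counts repeated
  columns as dependent. Sums over infinite sets are 0, so an infinite \<open>J\<close> never
  qualifies.\<close>

definition indep_family :: "'r set \<Rightarrow> ('c \<Rightarrow> 'r \<Rightarrow> 'a::field) \<Rightarrow> 'c set \<Rightarrow> bool" where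
  "indep_family S v J \<longleftrightarrow>
     (\<forall>a. (\<forall>i\<in>S. (\<Sum>j\<in>J. a j * v j i) = 0) \<longrightarrow> (\<forall>j\<in>J. a j = 0))"

lemma indep_familyD:
  assumes "indep_family S v J" "\<And>i. i \<in> S \<Longrightarrow> (\<Sum>j\<in>J. a j * v j i) = 0" "j \<in> J"
  shows "a j = 0"
  using assms unfolding indep_family_def by blast

lemma indep_family_empty: "indep_family S v {}"
  by (simp add: indep_family_def)

lemma indep_family_cong:
  assumes "\<And>j i. j \<in> J \<Longrightarrow> i \<in> S \<Longrightarrow> v j i = w j i"
  shows "indep_family S v J \<longleftrightarrow> indep_family S w J"
  unfolding indep_family_def using assms by simp

lemma indep_family_image:
  assumes "inj_on f X"
  shows "indep_family S v (f ` X) \<longleftrightarrow> indep_family S (\<lambda>x. v (f x)) X"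
proof
  assume L: "indep_family S v (f ` X)"
  show "indep_family S (\<lambda>x. v (f x)) X"
    unfolding indep_family_def
  proof (intro allI impI ballI)
    fix a x assume a: "\<forall>i\<in>S. (\<Sum>j\<in>X. a j * v (f j) i) = 0" and x: "x \<in> X"
    have "a (inv_into X f (f x)) = 0"
      by (rule indep_familyD[OF L, where a = "\<lambda>y. a (inv_into X f y)"])
        (use a x assms in \<open>auto simp: sum.reindex\<close>)
    then show "a x = 0" using x assms by simp
  qed
next
  assume R: "indep_family S (\<lambda>x. v (f x)) X"
  show "indep_family S v (f ` X)"
    unfolding indep_family_def
  proof (intro allI impI)
    fix a assume a: "\<forall>i\<in>S. (\<Sum>j\<in>f ` X. a j * v j i) = 0"
    have "a (f x) = 0" if "x \<in> X" for x
      by (rule indep_familyD[OF R, where a = "\<lambda>y. a (f y)"])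
        (use a that assms in \<open>auto simp: sum.reindex\<close>)
    then show "\<forall>j\<in>f ` X. a j = 0" by blast
  qed
qed

lemma indep_family_subset:
  assumes "indep_family S v Y" "X \<subseteq> Y" "finite Y"
  shows "indep_family S v X"
  unfolding indep_family_def
proof (intro allI impI ballI)
  fix a x assume a: "\<forall>i\<in>S. (\<Sum>j\<in>X. a j * v j i) = 0" and x: "x \<in> X"
  \<comment> \<open>A relation on \<open>X\<close> is extended by zero coefficients to
    \<open>Y\<close>.\<close>
  have "(\<Sum>j\<in>Y. (if j \<in> X then a j else 0) * v j i) = (\<Sum>j\<in>X. a j * v j i)" for i
    by (rule sum.mono_neutral_cong_right) (use assms in auto)
  then have "(if x \<in> X then a x else 0) = 0"
    by (intro indep_familyD[OF assms(1), where a = "\<lambda>j. if j \<in> X then a j else 0"])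
      (use a x assms(2) in auto)
  then show "a x = 0" using x by simp
qed

lemma indep_family_nonzero:
  assumes "indep_family S v J" "e \<in> J" "finite J"
  obtains i where "i \<in> S" "v e i \<noteq> 0"
proof -
  have "indep_family S v {e}" by (rule indep_family_subset[OF assms(1)]) (use assms in auto)
  then have "\<exists>i\<in>S. v e i \<noteq> 0"
    using indep_familyD[of S v "{e}" "\<lambda>_. 1" e] by auto
  then show ?thesis using that by blast
qed

text \<open>A nontrivial relation on \<open>insert e J\<close> must give \<open>e\<close> a nonzero
  coefficient, as otherwise it would be a relation on \<open>J\<close>. Dividing by that coefficient
  solves for the column \<open>e\<close>.\<close>

lemma dependent_insert_span:
  assumes "finite J" "indep_family S v J" "\<not> indep_family S v (insert e J)"
  obtains c where "\<And>i. i \<in> S \<Longrightarrow> v e i = (\<Sum>j\<in>J. c j * v j i)"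
proof -
  have e: "e \<notin> J" using assms by (auto simp: insert_absorb)
  obtain a where a: "\<forall>i\<in>S. (\<Sum>j\<in>insert e J. a j * v j i) = 0" and ne: "\<exists>j\<in>insert e J. a j \<noteq> 0"
    using assms(3) unfolding indep_family_def by blast
  have a': "a e * v e i + (\<Sum>j\<in>J. a j * v j i) = 0" if "i \<in> S" for i
    using a that e assms(1) by auto
  have "a e \<noteq> 0"
  proof
    assume "a e = 0"
    then have "a j = 0" if "j \<in> J" for j
      using a' that by (intro indep_familyD[OF assms(2), where a = a]) auto
    with ne \<open>a e = 0\<close> show False by auto
  qed
  then have "v e i = (\<Sum>j\<in>J. (- a j / a e) * v j i)" if "i \<in> S" for i
  proof -
    have "a e * (\<Sum>j\<in>J. (- a j / a e) * v j i) = - (\<Sum>j\<in>J. a j * v j i)"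
      using \<open>a e \<noteq> 0\<close> by (simp add: sum_distrib_left sum_negf)
    also have "\<dots> = a e * v e i" using a'[OF that] by (simp add: add_eq_0_iff2)
    finally show ?thesis using \<open>a e \<noteq> 0\<close> by simp
  qed
  then show ?thesis by (rule that)
qed

lemma indep_family_insert:
  assumes "finite J" "indep_family S v J"
    and "\<And>c. \<exists>i\<in>S. v e i \<noteq> (\<Sum>j\<in>J. c j * v j i)"
  shows "indep_family S v (insert e J)"
  using dependent_insert_span[OF assms(1,2)] assms(3) by metis

text \<open>A combination of the independent vectors \<open>U\<close> vanishes only if all its
  coefficients do, so relations among the vectors \<open>w\<close> are relations among their
  coordinate vectors, up to the nonzero scalings \<open>d\<close>. With \<open>d\<close> constantly
  1 this puts a matroid into coordinates; general \<open>d\<close> serves the count of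
  representations.\<close>

lemma indep_family_coordinates:
  fixes d :: "'c \<Rightarrow> 'a::field"
  assumes "finite B" "indep_family S U B"
    and w: "\<And>e i. e \<in> X \<Longrightarrow> i \<in> S \<Longrightarrow> w e i = d e * (\<Sum>b\<in>B. x e b * U b i)"
    and d: "\<And>e. e \<in> X \<Longrightarrow> d e \<noteq> 0"
  shows "indep_family S w X \<longleftrightarrow> indep_family B x X"
proof -
  have sum_eq: "(\<Sum>e\<in>X. a e * w e i) = (\<Sum>b\<in>B. (\<Sum>e\<in>X. (a e * d e) * x e b) * U b i)"
    if "i \<in> S" for a i
  proof -
    have "(\<Sum>e\<in>X. a e * w e i) = (\<Sum>e\<in>X. \<Sum>b\<in>B. a e * d e * x e b * U b i)"
      using w that by (simp add: sum_distrib_left mult.assoc)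
    also have "\<dots> = (\<Sum>b\<in>B. \<Sum>e\<in>X. a e * d e * x e b * U b i)" by (rule sum.swap)
    finally show ?thesis by (simp add: sum_distrib_right)
  qed
  show ?thesis
  proof
    assume L: "indep_family S w X"
    show "indep_family B x X"
      unfolding indep_family_def
    proof (intro allI impI ballI)
      fix a e assume a: "\<forall>b\<in>B. (\<Sum>e\<in>X. a e * x e b) = 0" and e: "e \<in> X"
      \<comment> \<open>Dividing each coefficient by its scaling turns a relation among coordinates
        into one among the scaled vectors.\<close>
      have *: "(\<Sum>e\<in>X. (a e / d e) * d e * x e b) = (\<Sum>e\<in>X. a e * x e b)" for b
        by (rule sum.cong) (use d in auto)
      have "a e / d e = 0"
      proof (rule indep_familyD[OF L _ e])
        fix i assume "i \<in> S"
        then show "(\<Sum>e\<in>X. (a e / d e) * w e i) = 0"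
          using a by (simp only: sum_eq *) simp
      qed
      then show "a e = 0" using d e by simp
    qed
  next
    assume R: "indep_family B x X"
    show "indep_family S w X"
      unfolding indep_family_def
    proof (intro allI impI ballI)
      fix a e assume a: "\<forall>i\<in>S. (\<Sum>e\<in>X. a e * w e i) = 0" and e: "e \<in> X"
      have "(\<Sum>e\<in>X. (a e * d e) * x e b) = 0" if "b \<in> B" for b
        by (rule indep_familyD[OF assms(2) _ that, where a = "\<lambda>b. \<Sum>e\<in>X. (a e * d e) * x e b"])
          (use a sum_eq in auto)
      then have "a e * d e = 0" using e by (rule indep_familyD[OF R])
      then show "a e = 0" using d e by simp
    qed
  qed
qed

text \<open>Contracting the columns \<open>J\<close>, which span all columns on the rows \<open>S\<close>, amounts to eliminating
  the rows \<open>S\<close> and keeping the Schur complement on the rows \<open>S'\<close>.\<close>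

lemma indep_family_contract:
  fixes c :: "'c \<Rightarrow> 'c \<Rightarrow> 'a::field"
  assumes "finite J" "finite K" "J \<inter> K = {}" "indep_family S v J"
    and c: "\<And>j i. j \<in> K \<Longrightarrow> i \<in> S \<Longrightarrow> v j i = (\<Sum>l\<in>J. c j l * v l i)"
  shows "indep_family (S \<union> S') v (K \<union> J) \<longleftrightarrow>
    indep_family S' (\<lambda>j i. v j i - (\<Sum>l\<in>J. c j l * v l i)) K"
proof -
  have un: "(\<Sum>j\<in>K \<union> J. g j) = (\<Sum>j\<in>K. g j) + (\<Sum>j\<in>J. g j)" for g :: "'c \<Rightarrow> 'a"
    using assms by (intro sum.union_disjoint) auto
  have comb: "(\<Sum>j\<in>K. a j * (\<Sum>l\<in>J. c j l * v l i)) = (\<Sum>l\<in>J. (\<Sum>j\<in>K. a j * c j l) * v l i)" for a i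
  proof -
    have "(\<Sum>j\<in>K. a j * (\<Sum>l\<in>J. c j l * v l i)) = (\<Sum>j\<in>K. \<Sum>l\<in>J. a j * c j l * v l i)"
      by (simp add: sum_distrib_left mult.assoc)
    also have "\<dots> = (\<Sum>l\<in>J. \<Sum>j\<in>K. a j * c j l * v l i)" by (rule sum.swap)
    finally show ?thesis by (simp add: sum_distrib_right)
  qed
  show ?thesis
  proof
    assume L: "indep_family (S \<union> S') v (K \<union> J)"
    show "indep_family S' (\<lambda>j i. v j i - (\<Sum>l\<in>J. c j l * v l i)) K"
      unfolding indep_family_def
    proof (intro allI impI ballI)
      fix a e
      assume a: "\<forall>i\<in>S'. (\<Sum>j\<in>K. a j * (v j i - (\<Sum>l\<in>J. c j l * v l i))) = 0" and e: "e \<in> K"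
      \<comment> \<open>The coefficients on \<open>J\<close> are those that subtract from each
        column of \<open>K\<close> its own combination of \<open>J\<close>.\<close>
      let ?a = "\<lambda>j. if j \<in> K then a j else - (\<Sum>i\<in>K. a i * c i j)"
      have J: "(\<Sum>j\<in>J. ?a j * v j i) = - (\<Sum>j\<in>K. a j * (\<Sum>l\<in>J. c j l * v l i))" for i
        unfolding comb sum_negf[symmetric] by (rule sum.cong) (use assms in \<open>auto simp: sum_negf\<close>)
      have K: "(\<Sum>j\<in>K. ?a j * v j i) = (\<Sum>j\<in>K. a j * v j i)" for i
        by (rule sum.cong) auto
      have "?a e = 0"
      proof (rule indep_familyD[OF L])
        show "e \<in> K \<union> J" using e by simp
        fix i assume i: "i \<in> S \<union> S'"
        have "(\<Sum>j\<in>K \<union> J. ?a j * v j i) = (\<Sum>j\<in>K. a j * (v j i - (\<Sum>l\<in>J. c j l * v l i)))"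
          unfolding un J K by (simp add: right_diff_distrib sum_subtractf)
        also have "\<dots> = 0"
        proof (cases "i \<in> S'")
          \<comment> \<open>Such a row lies in \<open>S\<close>, where each column of
            \<open>K\<close> equals its combination of \<open>J\<close>, so every difference is
            0.\<close>
          case False
          with i c show ?thesis by (intro sum.neutral) auto
        qed (use a in auto)
        finally show "(\<Sum>j\<in>K \<union> J. ?a j * v j i) = 0" .
      qed
      then show "a e = 0" using e by simp
    qed
  next
    assume R: "indep_family S' (\<lambda>j i. v j i - (\<Sum>l\<in>J. c j l * v l i)) K"
    show "indep_family (S \<union> S') v (K \<union> J)"
      unfolding indep_family_def
    proof (intro allI impI)
      fix a assume a: "\<forall>i\<in>S \<union> S'. (\<Sum>j\<in>K \<union> J. a j * v j i) = 0"
      \<comment> \<open>On the rows \<open>S\<close> a relation collapses to one among the columns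
        of \<open>J\<close> alone, whose independence there fixes the coefficients on
        \<open>J\<close> in terms of those on \<open>K\<close>.\<close>
      have bJ: "(\<Sum>j\<in>K. a j * c j l) + a l = 0" if "l \<in> J" for l
      proof (rule indep_familyD[OF assms(4) _ that, where a = "\<lambda>l. (\<Sum>j\<in>K. a j * c j l) + a l"])
        fix i assume i: "i \<in> S"
        have "(\<Sum>l\<in>J. ((\<Sum>j\<in>K. a j * c j l) + a l) * v l i) =
            (\<Sum>j\<in>K. a j * (\<Sum>l\<in>J. c j l * v l i)) + (\<Sum>l\<in>J. a l * v l i)"
          unfolding comb by (simp add: distrib_right sum.distrib)
        also have "(\<Sum>j\<in>K. a j * (\<Sum>l\<in>J. c j l * v l i)) = (\<Sum>j\<in>K. a j * v j i)"
          using c i by simp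
        also have "\<dots> + (\<Sum>l\<in>J. a l * v l i) = 0" using a i un by simp
        finally show "(\<Sum>l\<in>J. ((\<Sum>j\<in>K. a j * c j l) + a l) * v l i) = 0" .
      qed
      have K: "a j = 0" if "j \<in> K" for j
      proof (rule indep_familyD[OF R _ that])
        fix i assume i: "i \<in> S'"
        have "(\<Sum>j\<in>K. a j * (v j i - (\<Sum>l\<in>J. c j l * v l i))) =
            (\<Sum>j\<in>K. a j * v j i) - (\<Sum>l\<in>J. (\<Sum>j\<in>K. a j * c j l) * v l i)"
          unfolding comb[symmetric] by (simp add: right_diff_distrib sum_subtractf)
        also have "(\<Sum>l\<in>J. (\<Sum>j\<in>K. a j * c j l) * v l i) = (\<Sum>l\<in>J. (- a l) * v l i)"
          using bJ by (intro sum.cong refl arg_cong2[of _ _ _ _ times]) (simp add: eq_neg_iff_add_eq_0)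
        also have "(\<Sum>j\<in>K. a j * v j i) - \<dots> = (\<Sum>j\<in>K \<union> J. a j * v j i)"
          unfolding un by (simp add: sum_negf)
        also have "\<dots> = 0" using a i by simp
        finally show "(\<Sum>j\<in>K. a j * (v j i - (\<Sum>l\<in>J. c j l * v l i))) = 0" .
      qed
      have "a l = 0" if "l \<in> J" for l using bJ[OF that] K by simp
      with K show "\<forall>j\<in>K \<union> J. a j = 0" by blast
    qed
  qed
qed

section \<open>Size of independent families and maximal ones\<close>

lemma card_ge_2_field: "2 \<le> CARD('a::{field,finite})"
proof -
  have "card {0, 1 :: 'a} \<le> CARD('a)" by (rule card_mono) auto
  then show ?thesis by simp
qed

text \<open>Counting replaces dimension theory: distinct coefficient vectors give distinct
  combinations, so q^|J| is at most q^|S|.\<close>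

lemma indep_family_card_le:
  fixes v :: "'c \<Rightarrow> 'r \<Rightarrow> 'a::{field,finite}"
  assumes "finite S" "finite J" "indep_family S v J"
  shows "card J \<le> card S"
proof -
  let ?g = "\<lambda>a. \<lambda>i\<in>S. \<Sum>j\<in>J. a j * v j i"
  have "inj_on ?g (J \<rightarrow>\<^sub>E UNIV)"
  proof (rule inj_onI)
    fix a b assume a: "a \<in> J \<rightarrow>\<^sub>E UNIV" and b: "b \<in> J \<rightarrow>\<^sub>E UNIV" and eq: "?g a = ?g b"
    have eq': "(\<Sum>j\<in>J. a j * v j i) = (\<Sum>j\<in>J. b j * v j i)" if "i \<in> S" for i
      using fun_cong[OF eq, of i] that by simp
    show "a = b"
    proof (rule PiE_ext[OF a b])
      fix j assume "j \<in> J"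
      have "a j - b j = 0"
        by (rule indep_familyD[OF assms(3) _ \<open>j \<in> J\<close>, where a = "\<lambda>j. a j - b j"])
          (use eq' in \<open>auto simp: left_diff_distrib sum_subtractf\<close>)
      then show "a j = b j" by simp
    qed
  qed
  moreover have "?g ` (J \<rightarrow>\<^sub>E UNIV) \<subseteq> S \<rightarrow>\<^sub>E UNIV" by auto
  ultimately have "card (J \<rightarrow>\<^sub>E (UNIV :: 'a set)) \<le> card (S \<rightarrow>\<^sub>E (UNIV :: 'a set))"
    using assms by (intro card_inj_on_le[where f = ?g] finite_PiE) auto
  then have le: "CARD('a) ^ card J \<le> CARD('a) ^ card S"
    using assms by (simp add: card_PiE)
  then show ?thesis using card_ge_2_field[where 'a = 'a]
    by (auto intro: power_le_imp_le_exp[of "CARD('a)"])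
qed

text \<open>An independent subfamily of largest size spans, because adding any other column makes it
  dependent. The maximality clause lets its size be identified with the rank of a matroid.\<close>

lemma obtain_spanning_indep:
  fixes v :: "'c \<Rightarrow> 'r \<Rightarrow> 'a::field"
  assumes "finite C"
  obtains J c where "J \<subseteq> C" "indep_family S v J"
    "\<forall>X\<subseteq>C. indep_family S v X \<longrightarrow> card X \<le> card J"
    "\<forall>j\<in>C. \<forall>i\<in>S. v j i = (\<Sum>l\<in>J. c j l * v l i)"
proof -
  define F where "F = {X. X \<subseteq> C \<and> indep_family S v X}"
  have fin: "finite F" unfolding F_def using assms by auto
  have "{} \<in> F" unfolding F_def by (simp add: indep_family_empty)
  have "Max (card ` F) \<in> card ` F" using fin \<open>{} \<in> F\<close> by (intro Max_in) auto
  then obtain J where "J \<in> F" "card J = Max (card ` F)" by auto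
  then have J: "J \<in> F" "\<And>X. X \<in> F \<Longrightarrow> card X \<le> card J"
    using fin by simp_all
  have finJ: "finite J" using J(1) assms unfolding F_def by (auto intro: finite_subset)
  have "\<exists>c. \<forall>i\<in>S. v j i = (\<Sum>l\<in>J. c l * v l i)" if "j \<in> C" for j
  proof (cases "j \<in> J")
    case True
    have "v j i = (\<Sum>l\<in>J. (if l = j then 1 else 0) * v l i)" for i
      using True finJ by (simp add: if_distrib[of "\<lambda>x. x * _"] cong: if_cong)
    then show ?thesis by (intro exI[of _ "\<lambda>l. if l = j then 1 else 0"]) blast
  next
    case False
    then have "card (insert j J) > card J" using finJ by simp
    then have "insert j J \<notin> F" using J(2)[of "insert j J"] by (meson leD)
    then have "\<not> indep_family S v (insert j J)" using J(1) that unfolding F_def by blast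
    moreover have "indep_family S v J" using J(1) unfolding F_def by simp
    ultimately obtain c where "\<And>i. i \<in> S \<Longrightarrow> v j i = (\<Sum>l\<in>J. c l * v l i)"
      using dependent_insert_span[OF finJ] by blast
    then show ?thesis by blast
  qed
  then obtain c where "\<forall>j\<in>C. \<forall>i\<in>S. v j i = (\<Sum>l\<in>J. c j l * v l i)" by metis
  then show ?thesis using that[of J c] J unfolding F_def by auto
qed

section \<open>Counting representations\<close>

text \<open>Choose the vectors one at a time: the next one only has to avoid the span of those
  already chosen, which has at most q^|B| elements among q^|S| vectors.\<close>

lemma card_indep_families:
  fixes S :: "'r set" and B :: "'c set"
  assumes "finite S" "finite B" "card B \<le> card S"
  shows "(\<Prod>i<card B. real CARD('a::{field,finite}) ^ card S - real CARD('a) ^ i) \<le>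
    real (card {U \<in> B \<rightarrow>\<^sub>E (S \<rightarrow>\<^sub>E (UNIV :: 'a set)). indep_family S U B})"
  using assms(2,3)
proof (induction B rule: finite_induct)
  case empty
  then show ?case by (simp add: indep_family_empty)
next
  case (insert b B)
  let ?q = "real CARD('a)"
  let ?V = "S \<rightarrow>\<^sub>E (UNIV :: 'a set)"
  define F where "F = {U \<in> B \<rightarrow>\<^sub>E ?V. indep_family S U B}"
  \<comment> \<open>The span of the family \<open>U\<close>, as the image of a finite set of
    coefficient functions, which bounds its size.\<close>
  define sp where "sp U = (\<lambda>a. \<lambda>i\<in>S. \<Sum>j\<in>B. a j * U j i) ` (B \<rightarrow>\<^sub>E UNIV)" for U :: "'c \<Rightarrow> 'r \<Rightarrow> 'a"
  have finV: "finite ?V" using assms(1) by (intro finite_PiE) auto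
  have cardV: "card ?V = CARD('a) ^ card S" using assms(1) by (simp add: card_PiE)
  have finF: "finite F" unfolding F_def using insert.hyps finV
    by (intro finite_subset[OF _ finite_PiE[of B "\<lambda>_. ?V"]]) auto
  have sp_V: "sp U \<subseteq> ?V" for U unfolding sp_def by auto
  have "card (sp U) \<le> CARD('a) ^ card B" for U
  proof -
    have "card (sp U) \<le> card (B \<rightarrow>\<^sub>E (UNIV :: 'a set))"
      unfolding sp_def using insert.hyps by (intro card_image_le finite_PiE) auto
    then show ?thesis using insert.hyps by (simp add: card_PiE)
  qed
  then have "real (card (sp U)) \<le> ?q ^ card B" for U
    by (metis of_nat_le_iff of_nat_power)
  then have card_diff: "?q ^ card S - ?q ^ card B \<le> real (card (?V - sp U))" for U
    using card_Diff_subset[OF finite_subset[OF sp_V finV] sp_V] card_mono[OF finV sp_V] cardV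
    by (simp add: of_nat_diff)
  define G where "G = {U \<in> insert b B \<rightarrow>\<^sub>E ?V. indep_family S U (insert b B)}"
  have finG: "finite G" unfolding G_def using insert.hyps finV
    by (intro finite_subset[OF _ finite_PiE[of "insert b B" "\<lambda>_. ?V"]]) auto
  \<comment> \<open>The old family survives in the extended one, since it is
    \<open>undefined\<close> at the new index \<open>b\<close>; hence the map is injective.\<close>
  let ?g = "\<lambda>(U, u). U(b := u)"
  have "inj_on ?g (Sigma F (\<lambda>U. ?V - sp U))"
  proof (rule inj_onI, clarify)
    fix U u U' u'
    assume U: "U \<in> F" "U' \<in> F" and eq: "U(b := u) = U'(b := u')"
    have "U j = U' j" for j
      using fun_cong[OF eq, of j] U insert.hyps(2) unfolding F_def
      by (cases "j = b") (auto simp: PiE_def extensional_def)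
    then show "U = U' \<and> u = u'" using fun_cong[OF eq, of b] by auto
  qed
  moreover have "?g ` Sigma F (\<lambda>U. ?V - sp U) \<subseteq> G"
  proof clarify
    fix U u assume U: "U \<in> F" and u: "u \<in> ?V" "u \<notin> sp U"
    have "indep_family S (U(b := u)) (insert b B)"
    proof (rule indep_family_insert)
      have "indep_family S (U(b := u)) B \<longleftrightarrow> indep_family S U B"
        by (rule indep_family_cong) (use insert.hyps in auto)
      then show "indep_family S (U(b := u)) B" using U unfolding F_def by simp
      show "\<exists>i\<in>S. (U(b := u)) b i \<noteq> (\<Sum>j\<in>B. c j * (U(b := u)) j i)" for c
      proof (rule ccontr)
        assume "\<not> ?thesis"
        \<comment> \<open>Coefficients are cut down to \<open>B\<close> to match the extensional
          functions that parametrise \<open>sp U\<close>.\<close>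
        moreover have "(\<Sum>j\<in>B. c j * (U(b := u)) j i) = (\<Sum>j\<in>B. restrict c B j * U j i)" for i
          by (rule sum.cong) (use insert.hyps in auto)
        ultimately have "\<forall>i\<in>S. u i = (\<Sum>j\<in>B. restrict c B j * U j i)" by simp
        then have "u = (\<lambda>i\<in>S. \<Sum>j\<in>B. restrict c B j * U j i)"
          using u(1) by (auto simp: fun_eq_iff PiE_def extensional_def)
        then show False using u(2) unfolding sp_def by (auto intro!: image_eqI[of _ _ "restrict c B"])
      qed
    qed (use insert.hyps in auto)
    moreover have "U(b := u) \<in> insert b B \<rightarrow>\<^sub>E ?V"
      using U u unfolding F_def by (intro PiE_fun_upd) auto
    ultimately show "U(b := u) \<in> G" unfolding G_def by blast
  qed
  ultimately have le: "card (Sigma F (\<lambda>U. ?V - sp U)) \<le> card G"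
    using finG by (intro card_inj_on_le)
  have "(\<Prod>i<card (insert b B). ?q ^ card S - ?q ^ i) =
      (\<Prod>i<card B. ?q ^ card S - ?q ^ i) * (?q ^ card S - ?q ^ card B)"
    using insert.hyps by (simp add: mult.commute)
  \<comment> \<open>The second factor is nonnegative because \<open>card (insert b B)\<close> is at
    most \<open>card S\<close>.\<close>
  also have "\<dots> \<le> real (card F) * (?q ^ card S - ?q ^ card B)"
    unfolding F_def using insert.IH insert.prems insert.hyps
    by (intro mult_right_mono) (auto intro!: power_increasing)
  also have "\<dots> = (\<Sum>U\<in>F. ?q ^ card S - ?q ^ card B)" by simp
  also have "\<dots> \<le> (\<Sum>U\<in>F. real (card (?V - sp U)))" by (intro sum_mono card_diff)
  also have "\<dots> = real (card (Sigma F (\<lambda>U. ?V - sp U)))" using finF finV by (simp add: card_SigmaI)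
  also have "\<dots> \<le> real (card G)" using le by simp
  finally show ?case unfolding G_def .
qed

text \<open>The bijection is existential, so a block of columns counts in whatever order it carries
  the elements of \<open>E\<close>. This freedom is the source of the binomial coefficient in
  \<open>p_minor\<close>.\<close>

definition represents ::
  "'e set \<Rightarrow> 'e set set \<Rightarrow> 'r set \<Rightarrow> 'c set \<Rightarrow> ('c \<Rightarrow> 'r \<Rightarrow> 'a::field) \<Rightarrow> bool" where
  "represents E I S K w \<longleftrightarrow>
     (\<exists>f. bij_betw f E K \<and> (\<forall>X\<subseteq>E. X \<in> I \<longleftrightarrow> indep_family S w (f ` X)))"

lemma represents_cong:
  assumes "\<And>j i. j \<in> K \<Longrightarrow> i \<in> S \<Longrightarrow> v j i = w j i"
  shows "represents E I S K v \<longleftrightarrow> represents E I S K w"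
proof -
  have "indep_family S v (f ` X) \<longleftrightarrow> indep_family S w (f ` X)" if "bij_betw f E K" "X \<subseteq> E" for f X
    by (rule indep_family_cong) (use assms that in \<open>auto simp: bij_betw_def\<close>)
  then show ?thesis unfolding represents_def by blast
qed

text \<open>A representation is determined by the positions \<open>L\<close> of the zero columns, the images \<open>U\<close> of the
  basis vectors, and the scalings \<open>d\<close> of the remaining nonzero columns.\<close>

lemma card_representations:
  fixes x :: "'e \<Rightarrow> 'e \<Rightarrow> 'a::{field,finite}" and S :: "'r set" and K :: "'c set"
  assumes fin: "finite E" "finite S" "finite K" and cardK: "card K = card E"
    and BE: "B \<subseteq> E" and BS: "card B \<le> card S"
    and x_B: "\<And>b b'. b \<in> B \<Longrightarrow> b' \<in> B \<Longrightarrow> x b b' = (if b = b' then 1 else 0)"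
    and I: "\<And>X. X \<subseteq> E \<Longrightarrow> X \<in> I \<longleftrightarrow> indep_family B x X"
    and Z_def: "Z = {e \<in> E. \<forall>b\<in>B. x e b = 0}"
  shows "real (card E choose card Z) * (real CARD('a) - 1) ^ (card E - card B - card Z) *
      (\<Prod>i<card B. real CARD('a) ^ card S - real CARD('a) ^ i) \<le>
    real (card {w \<in> K \<rightarrow>\<^sub>E (S \<rightarrow>\<^sub>E (UNIV :: 'a set)). represents E I S K w})"
proof -
  let ?V = "S \<rightarrow>\<^sub>E (UNIV :: 'a set)"
  define R where "R = E - B - Z"
  define Ls where "Ls = {L. L \<subseteq> K \<and> card L = card Z}"
  define Us where "Us = {U \<in> B \<rightarrow>\<^sub>E ?V. indep_family S U B}"
  define Ds where "Ds = R \<rightarrow>\<^sub>E (UNIV - {0 :: 'a})"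
  have ZE: "Z \<subseteq> E" unfolding Z_def by auto
  have BZ: "B \<inter> Z = {}"
    using x_B unfolding Z_def by fastforce
  have finB: "finite B" using BE fin(1) finite_subset by blast
  have finV: "finite ?V" using fin(2) by (intro finite_PiE) auto
  have finR: "finite R" unfolding R_def using fin by auto
  have cardR: "card R = card E - card B - card Z"
    unfolding R_def using BE ZE BZ fin(1) finB
    by (subst card_Diff_subset; (subst card_Diff_subset)?) (auto intro: finite_subset)
  have cardLs: "card Ls = card E choose card Z"
    unfolding Ls_def using n_subsets[OF fin(3), of "card Z"] cardK by simp
  have cardDs: "card Ds = (CARD('a) - 1) ^ card R"
    unfolding Ds_def using finR by (simp add: card_PiE)
  \<comment> \<open>Each choice \<open>L\<close> of loop positions gets one bijection that sends
    exactly \<open>L\<close> onto the loops \<open>Z\<close>; glue a bijection on \<open>L\<close>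
    with one on the complement.\<close>
  have "\<exists>h. bij_betw h K E \<and> (\<forall>j\<in>K. h j \<in> Z \<longleftrightarrow> j \<in> L)" if "L \<in> Ls" for L
  proof -
    have L: "L \<subseteq> K" "card L = card Z" using that unfolding Ls_def by auto
    have "finite L" "finite Z" using L ZE fin finite_subset by blast+
    then obtain h1 where h1: "bij_betw h1 L Z" using L finite_same_card_bij by blast
    have "card (K - L) = card (E - Z)"
      using L ZE \<open>finite L\<close> \<open>finite Z\<close> cardK by (simp add: card_Diff_subset)
    then obtain h2 where h2: "bij_betw h2 (K - L) (E - Z)"
      using fin finite_same_card_bij[of "K - L" "E - Z"] by blast
    let ?h = "\<lambda>j. if j \<in> L then h1 j else h2 j"
    have "bij_betw ?h (L \<union> (K - L)) (Z \<union> (E - Z))"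
      by (rule bij_betw_disjoint_Un[OF h1 h2]) auto
    moreover have "L \<union> (K - L) = K" "Z \<union> (E - Z) = E" using L ZE by auto
    moreover have "?h j \<in> Z \<longleftrightarrow> j \<in> L" if "j \<in> K" for j
      using bij_betwE[OF h1] bij_betwE[OF h2] that by auto
    ultimately show ?thesis by (intro exI[of _ ?h]) simp
  qed
  then have "\<exists>h. \<forall>L\<in>Ls. bij_betw (h L) K E \<and> (\<forall>j\<in>K. h L j \<in> Z \<longleftrightarrow> j \<in> L)"
    by (intro bchoice) blast
  then obtain h where h: "\<And>L. L \<in> Ls \<Longrightarrow> bij_betw (h L) K E"
      "\<And>L j. L \<in> Ls \<Longrightarrow> j \<in> K \<Longrightarrow> h L j \<in> Z \<longleftrightarrow> j \<in> L"
    by blast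
  \<comment> \<open>Basis elements keep scale 1, so the columns at their positions are the vectors
    \<open>U\<close> themselves.\<close>
  define D where "D d e = (if e \<in> R then d e else 1)" for d :: "'e \<Rightarrow> 'a" and e
  define X where "X U e i = (\<Sum>b\<in>B. x e b * U b i)" for U :: "'e \<Rightarrow> 'r \<Rightarrow> 'a" and e i
  define g where "g = (\<lambda>(L, U, d). \<lambda>j\<in>K. \<lambda>i\<in>S. D d (h L j) * X U (h L j) i)"
  define W where "W = {w \<in> K \<rightarrow>\<^sub>E ?V. represents E I S K w}"
  have D_nz: "D d e \<noteq> 0" if "d \<in> Ds" for d e
    using that unfolding D_def Ds_def by auto
  have X_B: "X U b i = U b i" if "b \<in> B" for U b i
  proof -
    have "X U b i = (\<Sum>b'\<in>B. if b = b' then U b' i else 0)"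
      unfolding X_def by (rule sum.cong) (use x_B that in auto)
    then show ?thesis using that finB by simp
  qed
  have X_Z: "(\<forall>i\<in>S. X U e i = 0) \<longleftrightarrow> e \<in> Z" if "U \<in> Us" "e \<in> E" for U e
  proof
    assume "\<forall>i\<in>S. X U e i = 0"
    then have "x e b = 0" if "b \<in> B" for b
      using \<open>U \<in> Us\<close> that unfolding Us_def X_def
      by (intro indep_familyD[where J = B and S = S and a = "x e" and v = U]) auto
    then show "e \<in> Z" unfolding Z_def using that by auto
  qed (auto simp: Z_def X_def)
  \<comment> \<open>The data are read off the matrix in turn: \<open>L\<close> is the set of zero
    columns, \<open>U\<close> sits at the basis positions, and \<open>d\<close> is found by
    comparing a nonzero entry of each remaining column.\<close>
  have inj: "inj_on g (Ls \<times> Us \<times> Ds)"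
  proof (rule inj_onI)
    fix y y' assume y: "y \<in> Ls \<times> Us \<times> Ds" "y' \<in> Ls \<times> Us \<times> Ds" and "g y = g y'"
    obtain L U d L' U' d' where yy: "y = (L, U, d)" "y' = (L', U', d')"
      by (metis prod_cases3)
    have L: "L \<in> Ls" "L' \<in> Ls" and U: "U \<in> Us" "U' \<in> Us" and d: "d \<in> Ds" "d' \<in> Ds"
      and eq: "g (L, U, d) = g (L', U', d')"
      using y \<open>g y = g y'\<close> yy by auto
    have g_eq: "D d (h L j) * X U (h L j) i = D d' (h L' j) * X U' (h L' j) i"
      if "j \<in> K" "i \<in> S" for j i
      using fun_cong[OF fun_cong[OF eq, of j], of i] that unfolding g_def by simp
    have mem: "j \<in> L \<longleftrightarrow> j \<in> L'" if "j \<in> K" for j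
    proof -
      have "j \<in> L \<longleftrightarrow> (\<forall>i\<in>S. D d (h L j) * X U (h L j) i = 0)"
        using X_Z[OF U(1), of "h L j"] h(2)[OF L(1) that] bij_betwE[OF h(1)[OF L(1)]] that D_nz[OF d(1)]
        by auto
      also have "\<dots> \<longleftrightarrow> (\<forall>i\<in>S. D d' (h L' j) * X U' (h L' j) i = 0)"
        using g_eq[OF that] by simp
      also have "\<dots> \<longleftrightarrow> j \<in> L'"
        using X_Z[OF U(2), of "h L' j"] h(2)[OF L(2) that] bij_betwE[OF h(1)[OF L(2)]] that D_nz[OF d(2)]
        by auto
      finally show ?thesis .
    qed
    then have LL: "L = L'" using L unfolding Ls_def by blast
    have e_eq: "D d e * X U e i = D d' e * X U' e i" if "e \<in> E" "i \<in> S" for e i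
    proof -
      \<comment> \<open>Once \<open>L\<close> and \<open>L'\<close> agree, so do the chosen
        bijections, and equality of columns becomes equality at each element of
        \<open>E\<close>.\<close>
      obtain j where "j \<in> K" "h L j = e"
        using h(1)[OF L(1)] \<open>e \<in> E\<close> by (metis bij_betw_imp_surj_on imageE)
      then show ?thesis using g_eq[of j i] that LL by auto
    qed
    have UB: "U b i = U' b i" if "b \<in> B" "i \<in> S" for b i
      using e_eq[of b i] that BE X_B[OF that(1)] unfolding D_def R_def by auto
    have UP: "U \<in> B \<rightarrow>\<^sub>E ?V" "U' \<in> B \<rightarrow>\<^sub>E ?V" using U unfolding Us_def by auto
    have UU: "U = U'"
    proof (rule PiE_ext[OF UP])
      fix b assume b: "b \<in> B"
      show "U b = U' b"
        by (rule PiE_ext[OF PiE_mem[OF UP(1) b] PiE_mem[OF UP(2) b]]) (rule UB[OF b])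
    qed
    have "d e = d' e" if "e \<in> R" for e
    proof -
      have e: "e \<in> E" "e \<notin> Z" using that unfolding R_def by auto
      then obtain i where "i \<in> S" "X U e i \<noteq> 0" using X_Z[OF U(1)] by blast
      then show ?thesis using e_eq[OF e(1) \<open>i \<in> S\<close>] UU that unfolding D_def by simp
    qed
    then have "d = d'" using d unfolding Ds_def by (intro PiE_ext[of d R _ d']) auto
    with LL UU show "y = y'" unfolding yy by blast
  qed
  have img: "g ` (Ls \<times> Us \<times> Ds) \<subseteq> W"
  proof clarify
    fix L U d assume L: "L \<in> Ls" and U: "U \<in> Us" and d: "d \<in> Ds"
    let ?f = "inv_into K (h L)"
    let ?w = "g (L, U, d)"
    have f: "bij_betw ?f E K" using h(1)[OF L] by (rule bij_betw_inv_into)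
    have "X' \<in> I \<longleftrightarrow> indep_family S ?w (?f ` X')" if "X' \<subseteq> E" for X'
    proof -
      have fK: "?f e \<in> K" "h L (?f e) = e" if "e \<in> X'" for e
        using \<open>X' \<subseteq> E\<close> that f h(1)[OF L]
        by (auto simp: bij_betwE bij_betw_inv_into_right dest: bij_betwE)
      have "inj_on ?f X'" using f that by (meson bij_betw_imp_inj_on inj_on_subset)
      then have "indep_family S ?w (?f ` X') \<longleftrightarrow> indep_family S (\<lambda>e. ?w (?f e)) X'"
        by (rule indep_family_image)
      also have "\<dots> \<longleftrightarrow> indep_family B x X'"
        by (rule indep_family_coordinates[where d = "D d" and U = U, OF finB])
          (use U D_nz[OF d] fK in \<open>auto simp: Us_def g_def X_def\<close>)
      finally show ?thesis using I[OF that] by simp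
    qed
    then have "represents E I S K ?w" unfolding represents_def using f by blast
    moreover have "?w \<in> K \<rightarrow>\<^sub>E ?V" unfolding g_def by auto
    ultimately show "?w \<in> W" unfolding W_def by blast
  qed
  have "finite W" unfolding W_def
    using fin finV by (intro finite_subset[OF _ finite_PiE[of K "\<lambda>_. ?V"]]) auto
  then have "card (Ls \<times> Us \<times> Ds) \<le> card W" by (rule card_inj_on_le[OF inj img])
  then have "real (card Ls) * (real (card Us) * real (card Ds)) \<le> real (card W)"
    by (simp add: card_cartesian_product flip: of_nat_mult)
  moreover have "(\<Prod>i<card B. real CARD('a) ^ card S - real CARD('a) ^ i) \<le> real (card Us)"
    unfolding Us_def by (rule card_indep_families[OF fin(2) finB BS])
  then have "real (card Ls) * ((\<Prod>i<card B. real CARD('a) ^ card S - real CARD('a) ^ i) * real (card Ds))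
      \<le> real (card Ls) * (real (card Us) * real (card Ds))"
    by (intro mult_left_mono mult_right_mono) auto
  moreover have "real (card Ds) = (real CARD('a) - 1) ^ (card E - card B - card Z)"
    using card_ge_2_field[where 'a = 'a] by (simp add: cardDs cardR of_nat_diff)
  ultimately show ?thesis unfolding cardLs W_def by (simp add: mult_ac)
qed

section \<open>Contracting columns of a matrix\<close>

lemma indep_family_rows_mono:
  assumes "indep_family S v J" "S \<subseteq> S'"
  shows "indep_family S' v J"
  unfolding indep_family_def
proof (intro allI impI ballI)
  fix a j assume "\<forall>i\<in>S'. (\<Sum>j\<in>J. a j * v j i) = 0" "j \<in> J"
  then show "a j = 0" using assms(2) by (intro indep_familyD[OF assms(1), where a = a]) auto
qed

text \<open>Equal columns at distinct indices satisfy the relation with coefficients 1 and -1. This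
  supplies the injectivity clause of \<open>col_matroid\<close>.\<close>

lemma indep_family_entries_inj_on_col:
  assumes A: "A \<in> carrier_mat m n" and J: "J \<subseteq> {0..<n}"
    and ind: "indep_family {..<m} (\<lambda>j i. A $$ (i, j)) J"
  shows "inj_on (col A) J"
proof (rule inj_onI, rule ccontr)
  fix j j' assume j: "j \<in> J" "j' \<in> J" and eq: "col A j = col A j'" and ne: "j \<noteq> j'"
  have fin: "finite J" using J finite_subset by blast
  have jn: "j < n" "j' < n" using j J by auto
  have 2: "indep_family {..<m} (\<lambda>j i. A $$ (i, j)) {j, j'}"
    by (rule indep_family_subset[OF ind]) (use j fin in auto)
  have Aeq: "A $$ (i, j) = A $$ (i, j')" if "i < m" for i
    using arg_cong[OF eq, of "\<lambda>v. v $ i"] A jn that by auto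
  have "(if j = j then 1 else - 1 :: 'a) = 0"
    by (rule indep_familyD[OF 2, where a = "\<lambda>k. if k = j then 1 else - 1"]) (use ne Aeq in auto)
  then show False by simp
qed

text \<open>Bridge from the library's independence of a set of vectors to families indexed by
  columns: where \<open>col A\<close> is injective, coefficients on vectors and on indices
  correspond.\<close>

lemma col_matroid_indeps:
  fixes A :: "'a::field mat"
  assumes A: "A \<in> carrier_mat m n"
  shows "J \<in> indeps (col_matroid A) \<longleftrightarrow>
    J \<subseteq> {0..<n} \<and> indep_family {..<m} (\<lambda>j i. A $$ (i, j)) J"
proof -
  interpret vec_space "TYPE('a)" m .
  have dims: "dim_row A = m" "dim_col A = n" using A by auto
  have entries: "(lincomb a (col A ` J)) $ i = (\<Sum>j\<in>J. a (col A j) * A $$ (i, j))"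
    if "J \<subseteq> {0..<n}" "inj_on (col A) J" "i < m" for a i
  proof -
    have "col A ` J \<subseteq> carrier_vec m" using A by auto
    then have "(lincomb a (col A ` J)) $ i = (\<Sum>v\<in>col A ` J. a v * v $ i)"
      using that by (intro lincomb_index) auto
    also have "\<dots> = (\<Sum>j\<in>J. a (col A j) * A $$ (i, j))"
      unfolding sum.reindex[OF that(2)] o_def
      by (rule sum.cong) (use that A in auto)
    finally show ?thesis .
  qed
  have "lin_indpt (col A ` J) \<longleftrightarrow> indep_family {..<m} (\<lambda>j i. A $$ (i, j)) J"
    if J: "J \<subseteq> {0..<n}" and inj: "inj_on (col A) J"
  proof
    have fin: "finite J" using J finite_subset by blast
    assume L: "lin_indpt (col A ` J)"
    show "indep_family {..<m} (\<lambda>j i. A $$ (i, j)) J"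
      unfolding indep_family_def
    proof (intro allI impI ballI)
      fix a j assume a: "\<forall>i\<in>{..<m}. (\<Sum>j\<in>J. a j * A $$ (i, j)) = 0" and j: "j \<in> J"
      define a' where "a' = a \<circ> inv_into J (col A)"
      have cc: "col A ` J \<subseteq> carrier_vec m" using A by auto
      have "lincomb a' (col A ` J) = 0\<^sub>v m"
      proof (rule eq_vecI)
        show "dim_vec (lincomb a' (col A ` J)) = dim_vec (0\<^sub>v m)"
          using lincomb_dim[OF finite_imageI[OF fin] cc] by simp
        fix i assume "i < dim_vec (0\<^sub>v m :: 'a vec)"
        then have i: "i < m" by simp
        have "(\<Sum>j\<in>J. a' (col A j) * A $$ (i, j)) = (\<Sum>j\<in>J. a j * A $$ (i, j))"
          by (rule sum.cong) (use inj in \<open>auto simp: a'_def\<close>)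
        then show "lincomb a' (col A ` J) $ i = 0\<^sub>v m $ i"
          using entries[OF J inj i] a i by simp
      qed
      then have "a' \<in> col A ` J \<rightarrow> {0}"
        using not_lindepD[OF L, of "col A ` J" a'] fin by auto
      then show "a j = 0" using j inj unfolding a'_def by (auto simp: Pi_iff)
    qed
  next
    have fin: "finite J" using J finite_subset by blast
    assume R: "indep_family {..<m} (\<lambda>j i. A $$ (i, j)) J"
    show "lin_indpt (col A ` J)"
    proof (rule finite_lin_indpt2)
      show "finite (col A ` J)" using fin by simp
      show "col A ` J \<subseteq> carrier_vec m" using A by auto
      fix a assume "lincomb a (col A ` J) = 0\<^sub>v m"
      then have "(\<Sum>j\<in>J. a (col A j) * A $$ (i, j)) = 0" if "i < m" for i
        using entries[OF J inj that, of a] that by simp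
      then have "a (col A j) = 0" if "j \<in> J" for j
        using that by (intro indep_familyD[OF R, where a = "\<lambda>j. a (col A j)"]) auto
      then show "\<forall>v\<in>col A ` J. a v = 0" by blast
    qed
  qed
  then show ?thesis
    using indep_family_entries_inj_on_col[OF A, of J] unfolding col_matroid_def dims by auto
qed

lemma ground_col_matroid: "A \<in> carrier_mat m n \<Longrightarrow> ground (col_matroid A) = {0..<n}"
  by (auto simp: col_matroid_def)

text \<open>Take a largest independent set \<open>B\<close> of columns of a representing matrix and
  expand every column in it. The coordinates represent the same matroid, \<open>B\<close> gives the
  rank, and the loops are the elements with zero coordinate vector.\<close>

lemma representable_coordinates:
  fixes M :: "'e matroid"
  assumes M: "matroid M" and rep: "representable TYPE('a::field) M"
  obtains B and x :: "'e \<Rightarrow> 'e \<Rightarrow> 'a::field" where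
    "B \<subseteq> ground M" "card B = matroid_rank M"
    "\<And>b b'. b \<in> B \<Longrightarrow> b' \<in> B \<Longrightarrow> x b b' = (if b = b' then 1 else 0)"
    "\<And>X. X \<subseteq> ground M \<Longrightarrow> X \<in> indeps M \<longleftrightarrow> indep_family B x X"
    "loops M = {e \<in> ground M. \<forall>b\<in>B. x e b = 0}"
proof -
  have fin: "finite (ground M)" and sub: "indeps M \<subseteq> Pow (ground M)"
    using M unfolding matroid_def by auto
  have finI: "finite (indeps M)" using fin sub by (meson finite_Pow_iff finite_subset)
  obtain A :: "'a mat" and f where f: "bij_betw f (ground M) (ground (col_matroid A))"
    and fI: "\<And>X. X \<subseteq> ground M \<Longrightarrow> X \<in> indeps M \<longleftrightarrow> f ` X \<in> indeps (col_matroid A)"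
    using rep unfolding representable_def isomorphic_def by blast
  have A: "A \<in> carrier_mat (dim_row A) (dim_col A)" by simp
  define v where "v e i = A $$ (i, f e)" for e i
  define S where "S = {..<dim_row A}"
  have I: "X \<in> indeps M \<longleftrightarrow> indep_family S v X" if "X \<subseteq> ground M" for X
  proof -
    have "inj_on f X" using f that by (meson bij_betw_imp_inj_on inj_on_subset)
    moreover have "f ` X \<subseteq> {0..<dim_col A}"
      using f that ground_col_matroid[OF A] by (auto simp: bij_betw_def)
    ultimately show ?thesis
      unfolding fI[OF that] col_matroid_indeps[OF A] v_def S_def by (simp add: indep_family_image)
  qed
  obtain B c where B: "B \<subseteq> ground M" "indep_family S v B"
    and Bmax: "\<forall>X\<subseteq>ground M. indep_family S v X \<longrightarrow> card X \<le> card B"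
    and c: "\<forall>j\<in>ground M. \<forall>i\<in>S. v j i = (\<Sum>l\<in>B. c j l * v l i)"
    by (rule obtain_spanning_indep[OF fin, of S v])
  have finB: "finite B" using B fin finite_subset by blast
  \<comment> \<open>On \<open>B\<close> the coordinates are set to unit vectors outright, instead of
    showing that \<open>c\<close> has this form there.\<close>
  define x where "x e = (if e \<in> B then (\<lambda>b. if b = e then 1 else 0) else c e)" for e
  have vx: "v e i = 1 * (\<Sum>b\<in>B. x e b * v b i)" if "e \<in> ground M" "i \<in> S" for e i
    using c that finB by (simp add: x_def if_distrib[of "\<lambda>y. y * _"] cong: if_cong)
  have Ix: "X \<in> indeps M \<longleftrightarrow> indep_family B x X" if "X \<subseteq> ground M" for X
    unfolding I[OF that]
    by (rule indep_family_coordinates[OF finB B(2), where d = "\<lambda>_. 1"]) (use vx that in auto)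
  have "matroid_rank M = card B"
    unfolding matroid_rank_def
    by (rule Max_eqI) (use finI B Bmax I sub in auto)
  moreover have "loops M = {e \<in> ground M. \<forall>b\<in>B. x e b = 0}"
  proof (intro Set.equalityI subsetI)
    fix e assume e: "e \<in> loops M"
    then have eM: "e \<in> ground M" unfolding loops_def by simp
    have "x e b = 0" if "b \<in> B" for b
    proof (rule ccontr)
      assume "x e b \<noteq> 0"
      then have "indep_family B x {e}" using that unfolding indep_family_def by auto
      then have eI: "{e} \<in> indeps M" using Ix[of "{e}"] eM by simp
      \<comment> \<open>Loops are defined through bases, so the independent set \<open>{e}\<close>
        must be enlarged to a basis: a largest independent set containing \<open>e\<close> is
        maximal.\<close>
      define F where "F = {X \<in> indeps M. e \<in> X}"
      have F: "finite F" "{e} \<in> F" unfolding F_def using finI eI by auto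
      then have "Max (card ` F) \<in> card ` F" by (intro Max_in) auto
      then obtain X where X: "X \<in> F" "card X = Max (card ` F)" by auto
      have "C = X" if "C \<in> indeps M" "X \<subseteq> C" for C
      proof -
        have "C \<in> F" using that X(1) unfolding F_def by auto
        then have "card C \<le> card X" using F X(2) by simp
        moreover have "finite C" using that sub fin by (auto intro: finite_subset)
        ultimately show ?thesis using that by (metis card_seteq)
      qed
      then have "X \<in> bases M"
        using X(1) sub unfolding F_def bases_def basis_of_def by auto
      then show False using e X(1) unfolding loops_def F_def by blast
    qed
    then show "e \<in> {e \<in> ground M. \<forall>b\<in>B. x e b = 0}" using eM by blast
  next
    fix e assume e: "e \<in> {e \<in> ground M. \<forall>b\<in>B. x e b = 0}"
    have "e \<notin> X" if "X \<in> bases M" for X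
    proof
      assume "e \<in> X"
      have X: "X \<in> indeps M" "X \<subseteq> ground M" using that unfolding bases_def basis_of_def by auto
      then have "indep_family B x X" "finite X" using Ix fin finite_subset by blast+
      then obtain b where "b \<in> B" "x e b \<noteq> 0" using indep_family_nonzero \<open>e \<in> X\<close> by metis
      then show False using e by blast
    qed
    then show "e \<in> loops M" using e unfolding loops_def by blast
  qed
  ultimately show ?thesis using that[of B x] B Ix by (simp add: x_def)
qed

text \<open>The minor is obtained by contracting \<open>J\<close> and deleting every column outside
  \<open>J\<close> and \<open>K\<close>; on \<open>K\<close> its independent sets are those of the
  Schur complement on the lower rows.\<close>

lemma is_minor_col_matroidI:
  fixes A :: "'a::field mat" and c :: "nat \<Rightarrow> nat \<Rightarrow> 'a"
  assumes A: "A \<in> carrier_mat m n" and "k \<le> m"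
    and J: "J \<subseteq> {..<n}" "indep_family {..<k} (\<lambda>j i. A $$ (i, j)) J"
    and K: "K \<subseteq> {..<n}" "J \<inter> K = {}"
    and c: "\<And>j i. j < n \<Longrightarrow> i < k \<Longrightarrow> A $$ (i, j) = (\<Sum>l\<in>J. c j l * A $$ (i, l))"
    and rep: "represents (ground M) (indeps M) {k..<m} K
      (\<lambda>j i. A $$ (i, j) - (\<Sum>l\<in>J. c j l * A $$ (i, l)))"
  shows "is_minor M (col_matroid A)"
proof -
  let ?N = "col_matroid A"
  let ?v = "\<lambda>j i. A $$ (i, j)"
  have fin: "finite J" "finite K" using J K finite_subset by blast+
  have rows: "{..<k} \<union> {k..<m} = {..<m}" using \<open>k \<le> m\<close> by auto
  have gr: "ground ?N = {0..<n}" using A by (rule ground_col_matroid)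
  have JN: "J \<in> indeps ?N"
    unfolding col_matroid_indeps[OF A]
    using J(1) indep_family_rows_mono[OF J(2), of "{..<m}"] \<open>k \<le> m\<close> by auto
  \<comment> \<open>As \<open>J\<close> is independent it is its own only basis, so the existential
    in \<open>contraction\<close> reduces to adjoining \<open>J\<close>.\<close>
  then have basis: "basis_of ?N J B \<longleftrightarrow> B = J" for B
    unfolding basis_of_def by (auto 0 3)
  define L where "L = deletion (contraction ?N J) (ground ?N - J - K)"
  have "minor_by_steps ?N (contraction ?N J)"
    using J gr by (intro minor_by_steps.intros) auto
  then have minor: "minor_by_steps ?N L"
    unfolding L_def by (rule minor_by_steps.delete) (auto simp: contraction_def)
  have gL: "ground L = K"
    unfolding L_def using K gr by (auto simp: deletion_def contraction_def)
  have iL: "X \<in> indeps L \<longleftrightarrow>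
      indep_family {k..<m} (\<lambda>j i. A $$ (i, j) - (\<Sum>l\<in>J. c j l * A $$ (i, l))) X"
    if X: "X \<subseteq> K" for X
  proof -
    have "X \<subseteq> ground ?N - J" "X \<subseteq> ground ?N - J - (ground ?N - J - K)"
      using X K gr by auto
    then have "X \<in> indeps L \<longleftrightarrow> X \<union> J \<in> indeps ?N"
      unfolding L_def deletion_def contraction_def by (auto simp: basis)
    also have "\<dots> \<longleftrightarrow> indep_family ({..<k} \<union> {k..<m}) ?v (X \<union> J)"
      unfolding col_matroid_indeps[OF A] rows using X K J by auto
    also have "\<dots> \<longleftrightarrow>
        indep_family {k..<m} (\<lambda>j i. A $$ (i, j) - (\<Sum>l\<in>J. c j l * A $$ (i, l))) X"
      by (rule indep_family_contract) (use X K J c fin in \<open>auto intro: finite_subset\<close>)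
    finally show ?thesis .
  qed
  obtain f where f: "bij_betw f (ground M) K" and fI: "\<And>X. X \<subseteq> ground M \<Longrightarrow> X \<in> indeps M \<longleftrightarrow>
      indep_family {k..<m} (\<lambda>j i. A $$ (i, j) - (\<Sum>l\<in>J. c j l * A $$ (i, l))) (f ` X)"
    using rep unfolding represents_def by blast
  have "isomorphic M L"
    unfolding isomorphic_def gL
  proof (intro exI conjI allI impI)
    show "bij_betw f (ground M) K" by (rule f)
    fix X assume X: "X \<subseteq> ground M"
    then have "f ` X \<subseteq> K" using f by (auto simp: bij_betw_def)
    then show "X \<in> indeps M \<longleftrightarrow> f ` X \<in> indeps L" using fI[OF X] iL by simp
  qed
  then show ?thesis unfolding is_minor_def using minor by blast
qed

section \<open>Random matrices\<close>

text \<open>Independence of disjoint blocks in counting form: the columns of different blocks vary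
  freely, so the bounds \<open>\<rho>\<close> on the fractions multiply.\<close>

lemma card_PiE_blocks:
  fixes P :: "nat \<Rightarrow> 'c set"
  assumes "finite C" "finite V" "0 \<le> \<rho>"
    and "\<And>b. b < t \<Longrightarrow> P b \<subseteq> C" "disjoint_family_on P {..<t}"
    and "\<And>b. b < t \<Longrightarrow> Y b \<subseteq> P b \<rightarrow>\<^sub>E V"
    and "\<And>b. b < t \<Longrightarrow> real (card (Y b)) \<le> \<rho> * real (card V) ^ card (P b)"
  shows "real (card {w \<in> C \<rightarrow>\<^sub>E V. \<forall>b<t. restrict w (P b) \<in> Y b}) \<le> \<rho> ^ t * real (card V) ^ card C"
  using assms(1,4-)
proof (induction t arbitrary: C)
  case 0
  then show ?case by (simp add: card_PiE)
next
  case (Suc t)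
  define C' where "C' = C - P t"
  have finP: "finite (P t)"
    using Suc.prems(2)[of t] Suc.prems(1) by (auto intro: finite_subset)
  define Q where "Q = {w \<in> C' \<rightarrow>\<^sub>E V. \<forall>b<t. restrict w (P b) \<in> Y b}"
  define Q' where "Q' = {w \<in> C \<rightarrow>\<^sub>E V. \<forall>b<Suc t. restrict w (P b) \<in> Y b}"
  have disj: "P b \<inter> P t = {}" if "b < t" for b
    using disjoint_family_onD[OF Suc.prems(3), of b t] that by auto
  have sub: "P b \<subseteq> C'" if "b < t" for b
    using disj[OF that] Suc.prems(2)[of b] that unfolding C'_def by auto
  have IH: "real (card Q) \<le> \<rho> ^ t * real (card V) ^ card C'"
    unfolding Q_def
  proof (rule Suc.IH)
    show "finite C'" unfolding C'_def using Suc.prems by simp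
    show "disjoint_family_on P {..<t}"
      using Suc.prems(3) by (rule disjoint_family_on_mono[rotated]) auto
  qed (use sub Suc.prems(4,5) in auto)
  \<comment> \<open>Peel off the last block: a function is determined by its restrictions to that
    block and to the remaining indices.\<close>
  let ?g = "\<lambda>w. (restrict w (P t), restrict w C')"
  have inj: "inj_on ?g Q'"
  proof (rule inj_onI)
    fix w w' assume w: "w \<in> Q'" "w' \<in> Q'" and eq: "?g w = ?g w'"
    show "w = w'"
    proof (rule PiE_ext)
      show "w \<in> C \<rightarrow>\<^sub>E V" "w' \<in> C \<rightarrow>\<^sub>E V" using w unfolding Q'_def by auto
      fix j assume "j \<in> C"
      then show "w j = w' j"
        using eq unfolding C'_def by (cases "j \<in> P t") (auto dest!: fun_cong[of _ _ j])
    qed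
  qed
  have img: "?g ` Q' \<subseteq> Y t \<times> Q"
  proof clarify
    fix w assume w: "w \<in> Q'"
    have "restrict (restrict w C') (P b) = restrict w (P b)" if "b < t" for b
      using sub[OF that] by (simp add: Int_absorb1)
    then show "restrict w (P t) \<in> Y t \<and> restrict w C' \<in> Q"
      using w unfolding Q'_def Q_def by (auto simp: C'_def)
  qed
  have finY: "finite (Y t)"
    using Suc.prems(4)[of t] finP assms(2) by (intro finite_subset[OF _ finite_PiE[of "P t" "\<lambda>_. V"]]) auto
  have finQ: "finite Q" unfolding Q_def C'_def
    using Suc.prems(1) assms(2) by (intro finite_subset[OF _ finite_PiE[of "C - P t" "\<lambda>_. V"]]) auto
  have "card Q' \<le> card (Y t \<times> Q)"
    by (rule card_inj_on_le[OF inj img]) (use finY finQ in auto)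
  then have "real (card Q') \<le> real (card (Y t)) * real (card Q)"
    by (simp add: card_cartesian_product flip: of_nat_mult)
  also have "\<dots> \<le> (\<rho> * real (card V) ^ card (P t)) * (\<rho> ^ t * real (card V) ^ card C')"
    using Suc.prems(5)[of t] IH assms(3) by (intro mult_mono) auto
  also have "\<dots> = \<rho> ^ Suc t * real (card V) ^ (card (P t) + card C')"
    by (simp add: power_add mult_ac)
  also have "card (P t) + card C' = card C"
    unfolding C'_def using Suc.prems(1) Suc.prems(2)[of t] finP
    by (simp add: card_Diff_subset card_mono)
  finally show ?case unfolding Q'_def .
qed

lemma obtain_disjoint_blocks:
  assumes "finite Y" "e * t \<le> card Y"
  obtains P :: "nat \<Rightarrow> 'c set" where "\<And>b. b < t \<Longrightarrow> P b \<subseteq> Y" "\<And>b. b < t \<Longrightarrow> card (P b) = e"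
    "disjoint_family_on P {..<t}"
proof -
  have "\<exists>P. (\<forall>b<t. P b \<subseteq> Y \<and> card (P b) = e) \<and> disjoint_family_on P {..<t}"
    using assms
  proof (induction t arbitrary: Y)
    case 0
    then show ?case by (simp add: disjoint_family_on_def)
  next
    case (Suc t)
    \<comment> \<open>Reserve room for the first \<open>t\<close> blocks, so that at least
      \<open>e\<close> elements remain for the last one.\<close>
    obtain Z where Z: "Z \<subseteq> Y" "card Z = e * t"
      using obtain_subset_with_card_n[of "e * t" Y] Suc.prems by auto
    then obtain P where P: "\<forall>b<t. P b \<subseteq> Z \<and> card (P b) = e" "disjoint_family_on P {..<t}"
      using Suc.IH[of Z] Suc.prems finite_subset by (metis order_refl)
    have "e \<le> card (Y - Z)"
      using Z Suc.prems by (subst card_Diff_subset) (auto intro: finite_subset)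
    then obtain X where X: "X \<subseteq> Y - Z" "card X = e"
      using obtain_subset_with_card_n by metis
    have "disjoint_family_on (P(t := X)) {..<Suc t}"
      using P X unfolding disjoint_family_on_def by (auto simp: less_Suc_eq) blast+
    moreover have "\<forall>b<Suc t. (P(t := X)) b \<subseteq> Y \<and> card ((P(t := X)) b) = e"
      using P X Z by (auto simp: less_Suc_eq)
    ultimately show ?case by blast
  qed
  then show ?thesis using that by blast
qed

section \<open>Counting matrices without the minor\<close>

lemma card_carrier_mat: "card (carrier_mat m n :: 'a::finite mat set) = CARD('a) ^ (m * n)"
proof -
  let ?F = "({..<m} \<times> {..<n}) \<rightarrow>\<^sub>E (UNIV :: 'a set)"
  have "bij_betw (mat m n) ?F (carrier_mat m n)"
    unfolding bij_betw_def
  proof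
    show "inj_on (mat m n) ?F"
    proof (rule inj_onI)
      fix f g assume fg: "f \<in> ?F" "g \<in> ?F" and eq: "mat m n f = mat m n g"
      show "f = g"
      proof (rule PiE_ext[OF fg])
        fix ij assume "ij \<in> {..<m} \<times> {..<n}"
        then show "f ij = g ij"
          using arg_cong[OF eq, of "\<lambda>A. A $$ ij"] by (cases ij) auto
      qed
    qed
    show "mat m n ` ?F = carrier_mat m n"
    proof (intro Set.equalityI subsetI)
      fix A :: "'a mat" assume A: "A \<in> carrier_mat m n"
      have "A = mat m n (restrict (\<lambda>ij. A $$ ij) ({..<m} \<times> {..<n}))"
        using A by (intro eq_matI) auto
      then show "A \<in> mat m n ` ?F" by (rule image_eqI[where f = "mat m n"]) simp
    qed auto
  qed
  then have "card (carrier_mat m n :: 'a mat set) = card ?F" by (simp add: bij_betw_same_card)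
  then show ?thesis by (simp add: card_PiE card_cartesian_product)
qed

text \<open>With the upper rows fixed to \<open>T\<close>, the set \<open>J\<close> and the
  coefficients \<open>c\<close> are the same for all matrices of the fibre. Shifting the lower rows
  by \<open>c\<close> is then one injective map, under which a matrix without the minor fails to
  represent \<open>M\<close> on each of \<open>t\<close> disjoint blocks.\<close>

lemma card_non_minors_fibre:
  fixes M :: "'e matroid" and T :: "nat \<Rightarrow> nat \<Rightarrow> 'a::{field,finite}"
  assumes "k \<le> m" "k + card (ground M) * t \<le> n" "p \<le> 1"
    and p: "\<And>K :: nat set. finite K \<Longrightarrow> card K = card (ground M) \<Longrightarrow>
      p * real CARD('a) ^ ((m - k) * card (ground M)) \<le>
      real (card {w \<in> K \<rightarrow>\<^sub>E ({k..<m} \<rightarrow>\<^sub>E (UNIV :: 'a set)).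
        represents (ground M) (indeps M) {k..<m} K w})"
  shows "real (card {A \<in> carrier_mat m n. (\<forall>j<n. \<forall>i<k. A $$ (i, j) = T j i) \<and>
      \<not> is_minor M (col_matroid A)}) \<le> (1 - p) ^ t * real CARD('a) ^ ((m - k) * n)"
proof -
  let ?e = "card (ground M)"
  let ?V = "{k..<m} \<rightarrow>\<^sub>E (UNIV :: 'a set)"
  let ?q = "real CARD('a)"
  let ?rep = "\<lambda>K. represents (ground M) (indeps M) {k..<m} K"
  define Bad where "Bad = {A \<in> carrier_mat m n. (\<forall>j<n. \<forall>i<k. A $$ (i, j) = T j i) \<and>
      \<not> is_minor M (col_matroid A)}"
  have finV: "finite ?V" by (intro finite_PiE) auto
  have cardV: "card ?V = CARD('a) ^ (m - k)" by (simp add: card_PiE)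
  obtain J c where J: "J \<subseteq> {..<n}" "indep_family {..<k} T J"
    and "\<forall>X\<subseteq>{..<n}. indep_family {..<k} T X \<longrightarrow> card X \<le> card J"
    and c: "\<forall>j\<in>{..<n}. \<forall>i\<in>{..<k}. T j i = (\<Sum>l\<in>J. c j l * T l i)"
    by (rule obtain_spanning_indep[OF finite_lessThan, of n "{..<k}" T])
  have finJ: "finite J" using J finite_subset by blast
  have "card J \<le> k" using indep_family_card_le[OF _ finJ J(2)] by simp
  \<comment> \<open>Since \<open>J\<close> has at most \<open>k\<close> elements, at least
    \<open>n - k\<close> columns lie outside it, enough for all blocks.\<close>
  then have "?e * t \<le> card ({..<n} - J)"
    using assms(2) J finJ by (simp add: card_Diff_subset)
  then obtain P where P: "\<And>b. b < t \<Longrightarrow> P b \<subseteq> {..<n} - J" "\<And>b. b < t \<Longrightarrow> card (P b) = ?e"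
    and disj: "disjoint_family_on P {..<t}"
    using obtain_disjoint_blocks[of "{..<n} - J" ?e t] by auto
  have finP: "finite (P b)" if "b < t" for b
    using P(1)[OF that] by (rule finite_subset) simp
  \<comment> \<open>The columns of \<open>J\<close> stay unchanged, so the subtracted combinations
    can be recovered and the shift undone.\<close>
  define g where "g A = (\<lambda>j\<in>{..<n}. \<lambda>i\<in>{k..<m}.
    if j \<in> J then A $$ (i, j) else A $$ (i, j) - (\<Sum>l\<in>J. c j l * A $$ (i, l)))" for A :: "'a mat"
  define Y where "Y b = {w \<in> P b \<rightarrow>\<^sub>E ?V. \<not> ?rep (P b) w}" for b
  have "inj_on g Bad"
  proof (rule inj_onI)
    fix A A' assume A: "A \<in> Bad" "A' \<in> Bad" and eq: "g A = g A'"
    have carr: "A \<in> carrier_mat m n" "A' \<in> carrier_mat m n" using A unfolding Bad_def by auto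
    have g: "(if j \<in> J then A $$ (i, j) else A $$ (i, j) - (\<Sum>l\<in>J. c j l * A $$ (i, l))) =
        (if j \<in> J then A' $$ (i, j) else A' $$ (i, j) - (\<Sum>l\<in>J. c j l * A' $$ (i, l)))"
      if "j < n" "k \<le> i" "i < m" for i j
      using fun_cong[OF fun_cong[OF eq, of j], of i] that unfolding g_def by simp
    have gJ: "A $$ (i, l) = A' $$ (i, l)" if "l \<in> J" "k \<le> i" "i < m" for i l
      using g[of l i] that J by auto
    have "A $$ (i, j) = A' $$ (i, j)" if "i < m" "j < n" for i j
    proof (cases "i < k")
      case True
      then show ?thesis using A that unfolding Bad_def by auto
    next
      case False
      then have "(\<Sum>l\<in>J. c j l * A $$ (i, l)) = (\<Sum>l\<in>J. c j l * A' $$ (i, l))"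
        using gJ that by simp
      then show ?thesis using g[of j i] that False by (auto split: if_splits)
    qed
    then show "A = A'" using carr by (intro eq_matI) auto
  qed
  moreover have "g ` Bad \<subseteq> {w \<in> {..<n} \<rightarrow>\<^sub>E ?V. \<forall>b<t. restrict w (P b) \<in> Y b}"
  proof (rule image_subsetI)
    fix A assume A: "A \<in> Bad"
    have carr: "A \<in> carrier_mat m n" and top: "\<And>j i. j < n \<Longrightarrow> i < k \<Longrightarrow> A $$ (i, j) = T j i"
      and nm: "\<not> is_minor M (col_matroid A)"
      using A unfolding Bad_def by auto
    have gV: "g A \<in> {..<n} \<rightarrow>\<^sub>E ?V" unfolding g_def by (simp add: restrict_PiE_iff)
    have "restrict (g A) (P b) \<in> Y b" if b: "b < t" for b
    proof -
      have "\<not> ?rep (P b) (\<lambda>j i. A $$ (i, j) - (\<Sum>l\<in>J. c j l * A $$ (i, l)))"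
      proof
        assume rep: "?rep (P b) (\<lambda>j i. A $$ (i, j) - (\<Sum>l\<in>J. c j l * A $$ (i, l)))"
        have "is_minor M (col_matroid A)"
        proof (rule is_minor_col_matroidI[OF carr assms(1) J(1) _ _ _ _ rep])
          have "indep_family {..<k} (\<lambda>j i. A $$ (i, j)) J \<longleftrightarrow> indep_family {..<k} T J"
            by (rule indep_family_cong) (use top J in auto)
          then show "indep_family {..<k} (\<lambda>j i. A $$ (i, j)) J" using J by simp
          show "P b \<subseteq> {..<n}" "J \<inter> P b = {}" using P(1)[OF b] by auto
          fix j i assume ji: "j < n" "i < k"
          have "(\<Sum>l\<in>J. c j l * A $$ (i, l)) = (\<Sum>l\<in>J. c j l * T l i)"
            by (rule sum.cong) (use top J ji in auto)
          then show "A $$ (i, j) = (\<Sum>l\<in>J. c j l * A $$ (i, l))" using c ji top by auto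
        qed
        then show False using nm by contradiction
      qed
      \<comment> \<open>The block avoids \<open>J\<close>, so \<open>g A\<close> there consists of
        the shifted columns.\<close>
      moreover have "?rep (P b) (\<lambda>j i. A $$ (i, j) - (\<Sum>l\<in>J. c j l * A $$ (i, l))) \<longleftrightarrow>
          ?rep (P b) (restrict (g A) (P b))"
        by (rule represents_cong) (use P(1)[OF b] in \<open>auto simp: g_def\<close>)
      moreover have "restrict (g A) (P b) \<in> P b \<rightarrow>\<^sub>E ?V"
        using P(1)[OF b] gV by (auto simp: restrict_PiE_iff)
      ultimately show ?thesis unfolding Y_def by blast
    qed
    then show "g A \<in> {w \<in> {..<n} \<rightarrow>\<^sub>E ?V. \<forall>b<t. restrict w (P b) \<in> Y b}"
      using gV by simp
  qed
  moreover have "finite {w \<in> {..<n} \<rightarrow>\<^sub>E ?V. \<forall>b<t. restrict w (P b) \<in> Y b}"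
    using finV by (intro finite_subset[OF _ finite_PiE[of "{..<n}" "\<lambda>_. ?V"]]) auto
  ultimately have "card Bad \<le> card {w \<in> {..<n} \<rightarrow>\<^sub>E ?V. \<forall>b<t. restrict w (P b) \<in> Y b}"
    by (rule card_inj_on_le)
  then have "real (card Bad) \<le> real (card {w \<in> {..<n} \<rightarrow>\<^sub>E ?V. \<forall>b<t. restrict w (P b) \<in> Y b})"
    by simp
  also have "\<dots> \<le> (1 - p) ^ t * real (card ?V) ^ card {..<n}"
  proof (rule card_PiE_blocks)
    fix b assume b: "b < t"
    show "P b \<subseteq> {..<n}" using P(1)[OF b] by auto
    show "Y b \<subseteq> P b \<rightarrow>\<^sub>E ?V" unfolding Y_def by auto
    let ?G = "{w \<in> P b \<rightarrow>\<^sub>E ?V. ?rep (P b) w}"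
    have fin: "finite (P b \<rightarrow>\<^sub>E ?V)" using finP[OF b] finV by (intro finite_PiE) auto
    \<comment> \<open>Failing and representing blocks partition all blocks, so the lower bound
      \<open>p\<close> on the latter becomes the upper bound \<open>1 - p\<close> on the
      former.\<close>
    have "card (Y b) + card ?G = card (Y b \<union> ?G)"
      unfolding Y_def by (rule card_Un_disjoint[symmetric]) (use fin in auto)
    also have "Y b \<union> ?G = P b \<rightarrow>\<^sub>E ?V" unfolding Y_def by auto
    also have "card \<dots> = CARD('a) ^ ((m - k) * ?e)"
      using finP[OF b] P(2)[OF b] cardV by (simp add: card_PiE power_mult)
    finally have "card (Y b) + card ?G = CARD('a) ^ ((m - k) * ?e)" .
    then have "real (card (Y b)) + real (card ?G) = ?q ^ ((m - k) * ?e)"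
      by (simp flip: of_nat_add)
    then have "real (card (Y b)) \<le> (1 - p) * ?q ^ ((m - k) * ?e)"
      using p[OF finP[OF b] P(2)[OF b]] by (simp add: left_diff_distrib)
    then show "real (card (Y b)) \<le> (1 - p) * real (card ?V) ^ card (P b)"
      by (simp add: cardV P(2)[OF b] power_mult)
  qed (use assms(3) finV disj in auto)
  also have "\<dots> = (1 - p) ^ t * ?q ^ ((m - k) * n)" by (simp add: cardV power_mult)
  finally show ?thesis unfolding Bad_def .
qed

text \<open>The bound on a fibre does not depend on the upper rows, so it is summed over all of
  them.\<close>

lemma card_non_minors:
  fixes M :: "'e matroid"
  assumes "k \<le> m" "k + card (ground M) * t \<le> n" "p \<le> 1"
    and p: "\<And>K :: nat set. finite K \<Longrightarrow> card K = card (ground M) \<Longrightarrow>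
      p * real CARD('a::{field,finite}) ^ ((m - k) * card (ground M)) \<le>
      real (card {w \<in> K \<rightarrow>\<^sub>E ({k..<m} \<rightarrow>\<^sub>E (UNIV :: 'a set)).
        represents (ground M) (indeps M) {k..<m} K w})"
  shows "real (card {A \<in> carrier_mat m n. \<not> is_minor M (col_matroid (A :: 'a mat))}) \<le>
    (1 - p) ^ t * real CARD('a) ^ (m * n)"
proof -
  define Tops where "Tops = {..<n} \<rightarrow>\<^sub>E ({..<k} \<rightarrow>\<^sub>E (UNIV :: 'a set))"
  define Bad where "Bad T = {A \<in> carrier_mat m n. (\<forall>j<n. \<forall>i<k. A $$ (i, j) = T j i) \<and>
      \<not> is_minor M (col_matroid A)}" for T :: "nat \<Rightarrow> nat \<Rightarrow> 'a"
  have finT: "finite Tops" unfolding Tops_def by (intro finite_PiE) auto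
  have cardT: "card Tops = CARD('a) ^ (k * n)"
    unfolding Tops_def by (simp add: card_PiE power_mult)
  have "{A \<in> carrier_mat m n. \<not> is_minor M (col_matroid (A :: 'a mat))} \<subseteq> (\<Union>T\<in>Tops. Bad T)"
  proof
    fix A :: "'a mat"
    assume A: "A \<in> {A \<in> carrier_mat m n. \<not> is_minor M (col_matroid A)}"
    let ?T = "\<lambda>j\<in>{..<n}. \<lambda>i\<in>{..<k}. A $$ (i, j)"
    have "?T \<in> Tops" unfolding Tops_def by auto
    moreover have "A \<in> Bad ?T" using A unfolding Bad_def by auto
    ultimately show "A \<in> (\<Union>T\<in>Tops. Bad T)" by (rule UN_I[where B = Bad])
  qed
  moreover have "finite (\<Union>T\<in>Tops. Bad T)"
    by (rule finite_subset[OF _ finite_carrier_mat[of m n]]) (auto simp: Bad_def)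
  ultimately have "card {A \<in> carrier_mat m n. \<not> is_minor M (col_matroid (A :: 'a mat))}
      \<le> card (\<Union>T\<in>Tops. Bad T)"
    by (rule card_mono[rotated])
  also have "\<dots> \<le> (\<Sum>T\<in>Tops. card (Bad T))" using finT by (rule card_UN_le)
  finally have "real (card {A \<in> carrier_mat m n. \<not> is_minor M (col_matroid (A :: 'a mat))})
      \<le> (\<Sum>T\<in>Tops. real (card (Bad T)))"
    by (metis of_nat_le_iff of_nat_sum)
  also have "\<dots> \<le> (\<Sum>T\<in>Tops. (1 - p) ^ t * real CARD('a) ^ ((m - k) * n))"
    unfolding Bad_def by (intro sum_mono card_non_minors_fibre[OF assms(1-3)] p)
  also have "\<dots> = (1 - p) ^ t * real CARD('a) ^ (k * n + (m - k) * n)"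
    by (simp add: cardT power_add)
  also have "k * n + (m - k) * n = m * n"
    using assms(1) by (simp flip: add_mult_distrib)
  finally show ?thesis .
qed

section \<open>Success probability of one block and the final estimate\<close>

text \<open>Over the common denominator q^(s|E|), the total number of blocks, the numerator of
  \<open>p_minor\<close> is exactly the lower bound of \<open>card_representations\<close>.\<close>

lemma p_minor_bounds:
  fixes M :: "'e matroid"
  assumes q: "q = CARD('a::{field,finite})" and M: "matroid M" and rep: "representable TYPE('a) M"
    and r: "matroid_rank M \<le> card S" and fin: "finite S" "finite (K :: 'c set)"
    and cardK: "card K = card (ground M)"
  shows "0 < p_minor (card S) q M"
    and "p_minor (card S) q M * real q ^ (card S * card (ground M)) \<le>
      real (card {w \<in> K \<rightarrow>\<^sub>E (S \<rightarrow>\<^sub>E (UNIV :: 'a set)). represents (ground M) (indeps M) S K w})"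
proof -
  define e r l s where "e = card (ground M)" and "r = matroid_rank M" and "l = card (loops M)"
    and "s = card S"
  have finE: "finite (ground M)" using M unfolding matroid_def by simp
  have q2: "2 \<le> q" unfolding q by (rule card_ge_2_field)
  obtain B and x :: "'e \<Rightarrow> 'e \<Rightarrow> 'a" where
    B: "B \<subseteq> ground M" "card B = matroid_rank M"
    and x: "\<And>b b'. b \<in> B \<Longrightarrow> b' \<in> B \<Longrightarrow> x b b' = (if b = b' then 1 else 0)"
    and I: "\<And>X. X \<subseteq> ground M \<Longrightarrow> X \<in> indeps M \<longleftrightarrow> indep_family B x X"
    and L: "loops M = {e \<in> ground M. \<forall>b\<in>B. x e b = 0}"
    using representable_coordinates[OF M rep] by blast
  have le: "real (e choose l) * (real q - 1) ^ (e - r - l) * (\<Prod>i<r. real q ^ s - real q ^ i) \<le>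
    real (card {w \<in> K \<rightarrow>\<^sub>E (S \<rightarrow>\<^sub>E (UNIV :: 'a set)). represents (ground M) (indeps M) S K w})"
    using card_representations[OF finE fin cardK B(1) _ x I L] r
    unfolding q e_def r_def l_def s_def B(2) by simp
  have re: "r \<le> e" unfolding r_def e_def B(2)[symmetric] using B finE by (intro card_mono) auto
  have lee: "l \<le> e" unfolding l_def e_def loops_def using finE by (intro card_mono) auto
  \<comment> \<open>Each of the \<open>r\<close> factors contributes a denominator q^s.\<close>
  have prod: "(\<Prod>i<r. 1 - real q powi (int i - int s)) =
      (\<Prod>i<r. real q ^ s - real q ^ i) / real q ^ (s * r)"
  proof -
    have "(\<Prod>i<r. 1 - real q powi (int i - int s)) = (\<Prod>i<r. (real q ^ s - real q ^ i) / real q ^ s)"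
      using q2 by (intro prod.cong) (auto simp: power_int_diff diff_divide_distrib)
    also have "\<dots> = (\<Prod>i<r. real q ^ s - real q ^ i) / real q ^ (s * r)"
      by (simp add: prod_dividef power_mult)
    finally show ?thesis .
  qed
  have "s * e = s * (e - r) + s * r" using re by (simp flip: add_mult_distrib2)
  then have qe: "real q ^ (s * e) = real q ^ (s * (e - r)) * real q ^ (s * r)"
    by (simp add: power_add)
  have p: "p_minor s q M =
      real (e choose l) * (real q - 1) ^ (e - r - l) * (\<Prod>i<r. real q ^ s - real q ^ i) / real q ^ (s * e)"
    unfolding p_minor_def Let_def e_def[symmetric] r_def[symmetric] l_def[symmetric] prod qe
    by simp
  have "0 < (\<Prod>i<r. real q ^ s - real q ^ i)"
    using q2 r unfolding r_def[symmetric] s_def[symmetric]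
    by (intro prod_pos) (auto intro!: power_strict_increasing)
  then show "0 < p_minor (card S) q M"
    unfolding s_def[symmetric] p using q2 lee by simp
  show "p_minor (card S) q M * real q ^ (card S * card (ground M)) \<le>
      real (card {w \<in> K \<rightarrow>\<^sub>E (S \<rightarrow>\<^sub>E (UNIV :: 'a set)). represents (ground M) (indeps M) S K w})"
    unfolding s_def[symmetric] e_def[symmetric] using le q2 unfolding p by simp
qed

text \<open>The representing blocks are among all blocks, so their proportion, which
  \<open>p_minor\<close> bounds from below, is at most 1. This makes \<open>1 - p\<close>
  nonnegative in the product over blocks.\<close>

lemma p_minor_le_1:
  fixes M :: "'e matroid"
  assumes "q = CARD('a::{field,finite})" "matroid M" "representable TYPE('a) M"
    and "matroid_rank M \<le> s"
  shows "p_minor s q M \<le> 1"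
proof -
  let ?V = "{..<s} \<rightarrow>\<^sub>E (UNIV :: 'a set)"
  let ?K = "{..<card (ground M)}"
  have q: "0 < q" using assms(1) by simp
  have "p_minor s q M * real q ^ (s * card (ground M)) \<le>
      real (card {w \<in> ?K \<rightarrow>\<^sub>E ?V. represents (ground M) (indeps M) {..<s} ?K w})"
    using p_minor_bounds(2)[OF assms(1-3), of "{..<s}" ?K] assms(4) by simp
  also have "\<dots> \<le> real (card (?K \<rightarrow>\<^sub>E ?V))"
    by (intro of_nat_mono card_mono finite_PiE) auto
  also have "\<dots> = 1 * real q ^ (s * card (ground M))"
    using assms(1) by (simp add: card_PiE power_mult)
  finally show ?thesis using q by (subst (asm) mult_le_cancel_right_pos) auto
qed

theorem theorem6:
  fixes M :: "'e matroid" and m n q :: nat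
  assumes "q = CARD('a::{field,finite})"
    and "matroid M"
    and "\<not> free_matroid M"
    and "representable TYPE('a) M"
    and "m \<ge> matroid_rank M"
    and "n \<ge> card (ground M)"
  shows "measure_pmf.prob (uniform_mat m n) {A :: 'a mat. is_minor M (col_matroid A)} >
    (MAX k\<in>{0..min (n - card (ground M)) (m - matroid_rank M)}.
       (1 - real q powi (- (int n - int k))) *
       (1 - (1 - p_minor (m - k) q M) ^ ((n - k) div card (ground M))))"
proof -
  define e where "e = card (ground M)"
  let ?prob = "measure_pmf.prob (uniform_mat m n) {A :: 'a mat. is_minor M (col_matroid A)}"
  have q2: "2 \<le> q" unfolding assms(1) by (rule card_ge_2_field)
  \<comment> \<open>On an empty ground set the only subset is independent, so the matroid would be
    free. Hence division by |E| is meaningful.\<close>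
  have "ground M \<noteq> {}" using assms(2,3) unfolding matroid_def free_matroid_def by auto
  then have e: "0 < e" using assms(2) unfolding e_def matroid_def by (simp add: card_gt_0_iff)
  have "(1 - real q powi (- (int n - int k))) * (1 - (1 - p_minor (m - k) q M) ^ ((n - k) div e)) < ?prob"
    if "k \<le> min (n - e) (m - matroid_rank M)" for k
  proof -
    have k: "k \<le> m" "matroid_rank M \<le> m - k" "e \<le> n - k" "k \<le> n"
      using that assms(5,6) unfolding e_def by auto
    define t where "t = (n - k) div e"
    define p where "p = p_minor (m - k) q M"
    define G where "G = {A \<in> carrier_mat m n. is_minor M (col_matroid (A :: 'a mat))}"
    define F where "F = {A \<in> carrier_mat m n. \<not> is_minor M (col_matroid (A :: 'a mat))}"
    have "e * t \<le> n - k" unfolding t_def by simp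
    then have t: "k + e * t \<le> n" using k(4) by linarith
    \<comment> \<open>At least one block fits, which makes the failure bound
      \<open>(1 - p) ^ t\<close> strictly smaller than 1.\<close>
    have t0: "0 < t" using k(3) e unfolding t_def by (simp add: div_greater_zero_iff)
    have p01: "0 < p" "p \<le> 1"
      using p_minor_bounds(1)[OF assms(1,2,4), of "{..<m - k}" "{..<e}"]
        p_minor_le_1[OF assms(1,2,4) k(2)] k(2) unfolding p_def e_def by auto
    have "real (card F) \<le> (1 - p) ^ t * real CARD('a) ^ (m * n)"
      unfolding F_def
    proof (rule card_non_minors[OF k(1)])
      fix K :: "nat set" assume "finite K" "card K = card (ground M)"
      then show "p * real CARD('a) ^ ((m - k) * card (ground M)) \<le>
          real (card {w \<in> K \<rightarrow>\<^sub>E ({k..<m} \<rightarrow>\<^sub>E (UNIV :: 'a set)).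
            represents (ground M) (indeps M) {k..<m} K w})"
        using p_minor_bounds(2)[OF assms(1,2,4), of "{k..<m}" K] k(2) assms(1) unfolding p_def by simp
    qed (use t p01 in \<open>auto simp: e_def\<close>)
    moreover have "real (card G) + real (card F) = real CARD('a) ^ (m * n)"
    proof -
      have "card G + card F = card (G \<union> F)"
        by (rule card_Un_disjoint[symmetric])
          (auto simp: G_def F_def intro: finite_subset[OF _ finite_carrier_mat[of m n]])
      also have "G \<union> F = carrier_mat m n" unfolding G_def F_def by auto
      finally show ?thesis by (metis card_carrier_mat of_nat_add of_nat_power)
    qed
    ultimately have "(1 - (1 - p) ^ t) * real CARD('a) ^ (m * n) \<le> real (card G)"
      by (simp add: left_diff_distrib)
    then have "1 - (1 - p) ^ t \<le> real (card G) / real CARD('a) ^ (m * n)"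
      by (simp add: pos_le_divide_eq)
    also have "\<dots> = ?prob"
    proof -
      have "(carrier_mat m n :: 'a mat set) \<noteq> {}" using zero_carrier_mat by blast
      then have "?prob = real (card (carrier_mat m n \<inter> {A :: 'a mat. is_minor M (col_matroid A)})) /
          real (card (carrier_mat m n :: 'a mat set))"
        unfolding uniform_mat_def by (rule measure_pmf_of_set[OF _ finite_carrier_mat])
      moreover have "carrier_mat m n \<inter> {A :: 'a mat. is_minor M (col_matroid A)} = G"
        unfolding G_def by auto
      ultimately show ?thesis by (simp add: card_carrier_mat)
    qed
    finally have prob: "1 - (1 - p) ^ t \<le> ?prob" .
    \<comment> \<open>Strictness: a positive quantity is multiplied by a factor strictly below
      1.\<close>
    have "(1 - p) ^ t < 1" using p01 t0 by (intro power_less_one_iff[THEN iffD2]) auto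
    moreover have "0 < real q powi (- (int n - int k))" using q2 by simp
    ultimately have "(1 - real q powi (- (int n - int k))) * (1 - (1 - p) ^ t) < 1 * (1 - (1 - p) ^ t)"
      by (intro mult_strict_right_mono) auto
    then show ?thesis using prob unfolding p_def t_def by simp
  qed
  \<comment> \<open>The maximum is over a finite nonempty set, so the strict bound for each
    \<open>k\<close> suffices.\<close>
  then show ?thesis
    unfolding e_def[symmetric] by (subst Max_less_iff) auto
qed

end
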